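(* Let $\gamma\in\mathbb{R}$ and let $p\geq 2$. (i) If $d\geq 2$ and $u\in C^1_c(\mathbb{R}^d\setminus\{0\})$ is antisymmetric, then $$ \int_{\mathbb{R}^d}\frac{|\nabla u(x)|^p}{|x|^{\gamma}}\,dx\geq C_H(d,p,\gamma)\int_{\mathbb{R}^d}\frac{|u(x)|^p}{|x|^{p+\gamma}}\,dx, $$ where $$ C_H(d,p,\gamma)=\left(\frac{2(p-2+\gamma)d(d-1)}{p^2}+\left(\frac{d^2-p-\gamma}{p}\right)^2\right)^{\frac{p}{2}}. $$ (ii) If $d\geq 1$ and $u\in C^1_c(\mathbb{R}^d\setminus\{0\})$ is odd, then $$ \int_{\mathbb{R}^d}\frac{|\nabla u(x)|^p}{|x|^{\gamma}}\,dx\geq D_H(d,p,\gamma)\int_{\mathbb{R}^d}\frac{|u(x)|^p}{|x|^{p+\gamma}}\,dx, $$ where $$ D_H(d,p,\gamma)=\left(\frac{4(p-2+\gamma)}{p^2}+\left(\frac{d-p-\gamma+2}{p}\right)^2\right)^{\frac{p}{2}}. $$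
   Context: A function $u$ is antisymmetric if $u(x_1,\dots,x_i,\dots,x_j,\dots,x_d)=-u(x_1,\dots,x_j,\dots,x_i,\dots,x_d)$ for all $1\leq i\neq j\leq d$ (i.e. it changes sign when any two coordinates are swapped), and odd if $u(-x)=-u(x)$. $C^1_c(\mathbb{R}^d\setminus\{0\})$ is the space of $C^1$ functions with compact support contained in $\mathbb{R}^d\setminus\{0\}$. $|\cdot|$ denotes the Euclidean norm. *)

theory Defs
  imports "HOL-Analysis.Analysis"
begin

definition grad :: "(real ^ 'n \<Rightarrow> real) \<Rightarrow> real ^ 'n \<Rightarrow> real ^ 'n" where
  "grad u x = (\<chi> i. frechet_derivative u (at x) (axis i 1))"

(* Meant for open S. Functions on S are total functions here, and the support condition
   forces them to vanish outside S (extension by zero). *)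
definition C1_compact_support :: "(real ^ 'n) set \<Rightarrow> (real ^ 'n \<Rightarrow> real) set" where
  "C1_compact_support S =
     {u. u differentiable_on S \<and> continuous_on S (grad u) \<and>
         compact (closure {x. u x \<noteq> 0}) \<and> closure {x. u x \<noteq> 0} \<subseteq> S}"

definition antisymmetric :: "(real ^ 'n \<Rightarrow> real) \<Rightarrow> bool" where
  "antisymmetric u \<longleftrightarrow>
     (\<forall>i j. i \<noteq> j \<longrightarrow> (\<forall>x. u (\<chi> k. x $ Transposition.transpose i j k) = - u x))"

definition odd_function :: "(real ^ 'n \<Rightarrow> real) \<Rightarrow> bool" where
  "odd_function u \<longleftrightarrow> (\<forall>x. u (- x) = - u x)"

(* The base of the power is nonnegative, so powr is the usual real power: with s = p + \<gamma>
   it equals ((d - s)^2 + d (d - 1) (d^2 + d - 4)) / p^2 in C_H (d \<ge> 2)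
   and ((d - s)^2 + 4 (d - 1)) / p^2 in D_H (d \<ge> 1). *)
definition C_H :: "nat \<Rightarrow> real \<Rightarrow> real \<Rightarrow> real" where
  "C_H d p \<gamma> =
     (2 * (p - 2 + \<gamma>) * real d * (real d - 1) / p\<^sup>2 + (((real d)\<^sup>2 - p - \<gamma>) / p)\<^sup>2) powr (p / 2)"

definition D_H :: "nat \<Rightarrow> real \<Rightarrow> real \<Rightarrow> real" where
  "D_H d p \<gamma> =
     (4 * (p - 2 + \<gamma>) / p\<^sup>2 + ((real d - p - \<gamma> + 2) / p)\<^sup>2) powr (p / 2)"

end

theory Submission
  imports Defs
begin

text \<open>
Both parts reduce to a Hardy inequality \<open>\<integral>|\<nabla>z|\<^sup>2 \<ge> H \<integral>z\<^sup>2/|x|\<^sup>2\<close> with exponent two and without weight,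
for functions \<open>z\<close> with the symmetry of \<open>u\<close>.

The reduction. Put \<open>v = |u|\<^bsup>p/2-1\<^esup> u\<close>, so that \<open>|\<nabla>v|\<^sup>2 = (p\<^sup>2/4) |u|\<^bsup>p-2\<^esup> |\<nabla>u|\<^sup>2\<close>, and
\<open>z = |x|\<^bsup>-k\<^esup> v\<close> with \<open>k = (p-2+\<gamma>)/2\<close>. Both operations preserve antisymmetry and oddness.
Expanding the square shows that \<open>\<integral>|\<nabla>v|\<^sup>2/|x|\<^bsup>2k\<^esup>\<close> equals \<open>\<integral>|\<nabla>z|\<^sup>2\<close> plus
\<open>(k\<^sup>2 - k(d-2)) \<integral>z\<^sup>2/|x|\<^sup>2\<close> (lemma \<open>weighted_energy_identity\<close>), and
\<open>\<integral>z\<^sup>2/|x|\<^sup>2 = \<integral>|u|\<^sup>p/|x|\<^bsup>p+\<gamma>\<^esup>\<close>. What remains is to pass from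
\<open>\<integral>|u|\<^bsup>p-2\<^esup> |\<nabla>u|\<^sup>2/|x|\<^bsup>2k\<^esup>\<close> to \<open>\<integral>|\<nabla>u|\<^sup>p/|x|\<^sup>\<gamma>\<close>; instead of Hoelder's inequality, the
tangent line of the convex function \<open>s \<mapsto> s\<^bsup>p/2\<^esup>\<close> at the critical constant does this pointwise
(lemma \<open>hardy_power\<close>).

The inequality with exponent two (lemma \<open>hardy_root_system\<close>). Suppose \<open>z\<close> is odd under the
reflections in the hyperplanes \<open>l \<bullet> x = 0\<close>, \<open>l \<in> \<Phi>\<close>, and the product \<open>P\<close> of the \<open>|l \<bullet> x|\<^sup>c\<close> is
harmonic off these hyperplanes; it is homogeneous of degree \<open>D = c |\<Phi>|\<close>. Then
\<open>\<phi> = |x|\<^bsup>-e\<^esup> P\<close> with \<open>e = D + (d-2)/2\<close> is a positive solution of \<open>-\<Delta>\<phi> = e\<^sup>2 \<phi>/|x|\<^sup>2\<close> there,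
and integrating \<open>|\<nabla>z - z \<nabla>\<phi>/\<phi>|\<^sup>2 \<ge> 0\<close> by parts gives \<open>H = e\<^sup>2\<close>. The singularities of
\<open>\<nabla>\<phi>/\<phi>\<close> on the hyperplanes are harmless because \<open>z\<close> vanishes there, which makes \<open>z\<^sup>2/(l \<bullet> x)\<close>
Lipschitz continuous; and for a compactly supported Lipschitz function the integral of a directional
derivative vanishes by translation invariance (lemma \<open>integral_directional_derivative\<close>).

Antisymmetric functions. \<open>P\<close> is the absolute value of the Vandermonde product, so
\<open>D = d(d-1)/2\<close> and \<open>H = ((d\<^sup>2-2)/2)\<^sup>2\<close>.

Odd functions. An odd function need not vanish on any fixed hyperplane. It is, however, a sum of
functions that are each even or odd in every coordinate, and only pieces that are odd in at least one
coordinate occur. The pieces are orthogonal for both quadratic forms, and each one satisfies the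
inequality with \<open>P = |x\<^sub>i|\<close>, that is with \<open>D = 1\<close> and \<open>H = (d/2)\<^sup>2\<close> (lemma \<open>hardy_odd\<close>).
\<close>

section \<open>Continuously differentiable functions supported in an annulus\<close>

text \<open>The gradient \<open>g\<close> is carried along explicitly, so that closure properties also compute it. The last
clause encodes a compact support that avoids the origin.\<close>

definition test_function :: "('a::euclidean_space \<Rightarrow> real) \<Rightarrow> ('a \<Rightarrow> 'a) \<Rightarrow> bool" where
  "test_function z g \<longleftrightarrow>
     (\<forall>x. (z has_derivative (\<lambda>h. g x \<bullet> h)) (at x)) \<and> continuous_on UNIV g \<and>
     (\<exists>\<epsilon>>0. \<exists>R. \<forall>x. norm x < \<epsilon> \<or> R < norm x \<longrightarrow> z x = 0)"

lemma test_function_has_derivative: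
  "test_function z g \<Longrightarrow> (z has_derivative (\<lambda>h. g x \<bullet> h)) (at x)"
  by (simp add: test_function_def)

lemma test_function_continuous:
  assumes "test_function z g"
  shows "continuous_on UNIV z" "continuous_on UNIV g"
  using assms
  by (auto simp: test_function_def intro!: has_derivative_continuous_on
      elim: has_derivative_at_withinI)

lemma test_function_borel:
  assumes "test_function z g"
  shows "z \<in> borel_measurable borel" "g \<in> borel_measurable borel"
  using test_function_continuous[OF assms] by (auto intro: borel_measurable_continuous_onI)

lemma test_function_support:
  assumes "test_function z g"
  obtains \<epsilon> R where "\<epsilon> > 0" "R > 0"
    "\<And>x. norm x < \<epsilon> \<or> R < norm x \<Longrightarrow> z x = 0" "\<And>x. norm x < \<epsilon> \<or> R < norm x \<Longrightarrow> g x = 0"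
proof -
  obtain \<epsilon> R where *: "\<epsilon> > 0" "\<And>x. norm x < \<epsilon> \<or> R < norm x \<Longrightarrow> z x = 0"
    using assms by (auto simp: test_function_def)
  have "g x = 0" if x: "norm x < \<epsilon> \<or> max R 1 < norm x" for x
  proof -
    define U where "U = {y::'a. norm y < \<epsilon>} \<union> {y. R < norm y}"
    have "open U"
      unfolding U_def by (intro open_Un open_Collect_less continuous_intros)
    moreover have "x \<in> U" using x by (auto simp: U_def)
    moreover have "((\<lambda>_. 0) has_derivative (\<lambda>_. 0)) (at x)" by simp
    ultimately have "(z has_derivative (\<lambda>_. 0)) (at x)"
      by (intro has_derivative_transform_within_open[of "\<lambda>_. 0" "\<lambda>_. 0" x UNIV U z]) (auto simp: U_def * )
    then have "(\<lambda>h. g x \<bullet> h) = (\<lambda>_. 0)"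
      using has_derivative_unique test_function_has_derivative[OF assms] by blast
    then have "g x \<bullet> g x = 0" by (rule fun_cong)
    then show ?thesis by simp
  qed
  with * show ?thesis by (intro that[of \<epsilon> "max R 1"]) auto
qed

text \<open>Weights such as \<open>1/|x|\<^sup>2\<close> are singular only at the origin, which the supports avoid.\<close>

lemma integrable_annulus:
  fixes f :: "'a::euclidean_space \<Rightarrow> real"
  assumes "continuous_on (- {0}) f" "\<epsilon> > 0" "\<And>x. norm x < \<epsilon> \<or> R < norm x \<Longrightarrow> f x = 0"
  shows "integrable lborel f"
proof -
  define S where "S = cball 0 R - ball (0::'a) \<epsilon>"
  have "compact S" unfolding S_def by (intro compact_diff) auto
  moreover have "continuous_on S f"
    using assms(2) by (intro continuous_on_subset[OF assms(1)]) (auto simp: S_def)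
  ultimately have "integrable lborel (\<lambda>x. indicator S x *\<^sub>R f x)"
    by (rule borel_integrable_compact)
  also have "(\<lambda>x. indicator S x *\<^sub>R f x) = f"
    using assms(3) by (fastforce simp: S_def indicator_def not_less)
  finally show ?thesis .
qed

lemma test_function_bounded_gradient:
  assumes "test_function z g"
  obtains K where "K > 0" "\<And>x. norm (g x) \<le> K"
proof -
  obtain \<epsilon> R where *: "\<epsilon> > 0" "R > 0" "\<And>x. norm x < \<epsilon> \<or> R < norm x \<Longrightarrow> g x = 0"
    using test_function_support[OF assms] by metis
  have "compact (g ` cball 0 R)"
    using test_function_continuous(2)[OF assms]
    by (intro compact_continuous_image) (auto intro: continuous_on_subset)
  then obtain K where K: "\<And>y. y \<in> g ` cball 0 R \<Longrightarrow> norm y \<le> K"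
    using compact_imp_bounded bounded_iff by metis
  have "norm (g x) \<le> max K 1" for x
  proof (cases "norm x \<le> R")
    case True
    then have "norm (g x) \<le> K" by (intro K) auto
    then show ?thesis by simp
  next
    case False
    then show ?thesis using *(3)[of x] by simp
  qed
  then show ?thesis by (intro that[of "max K 1"]) auto
qed

lemma test_function_lipschitz:
  assumes "test_function z g"
  obtains K where "K > 0" "\<And>x y. \<bar>z x - z y\<bar> \<le> K * norm (x - y)"
proof -
  obtain K where K: "K > 0" "\<And>x. norm (g x) \<le> K"
    using test_function_bounded_gradient[OF assms] by metis
  have "norm (z x - z y) \<le> K * norm (x - y)" for x y
  proof (rule differentiable_bound[of UNIV])
    show "onorm ((\<bullet>) (g x)) \<le> K" for x
    proof (rule onorm_bound)
      show "norm (g x \<bullet> h) \<le> K * norm h" for h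
        using Cauchy_Schwarz_ineq2[of "g x" h] mult_right_mono[OF K(2)[of x] norm_ge_zero[of h]] by simp
    qed (use K in auto)
  qed (auto intro: test_function_has_derivative[OF assms])
  with K(1) show ?thesis by (intro that[of K]) auto
qed

lemma test_function_compose:
  assumes "test_function z g"
    and "\<And>s. (\<phi> has_real_derivative \<phi>' s) (at s)" "continuous_on UNIV \<phi>'" "\<phi> 0 = 0"
  shows "test_function (\<lambda>x. \<phi> (z x)) (\<lambda>x. \<phi>' (z x) *\<^sub>R g x)"
proof -
  obtain \<epsilon> R where *: "\<epsilon> > 0" "\<And>x. norm x < \<epsilon> \<or> R < norm x \<Longrightarrow> z x = 0"
    using test_function_support[OF assms(1)] by metis
  have "((\<lambda>x. \<phi> (z x)) has_derivative (\<lambda>h. (\<phi>' (z x) *\<^sub>R g x) \<bullet> h)) (at x)" for x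
    by (rule has_derivative_eq_rhs[OF has_derivative_compose
          [OF test_function_has_derivative[OF assms(1)]
            assms(2)[unfolded has_field_derivative_def]]]) simp
  moreover have "continuous_on UNIV (\<lambda>x. \<phi>' (z x) *\<^sub>R g x)"
    using test_function_continuous[OF assms(1)] assms(3)
    by (intro continuous_intros continuous_on_compose2[OF assms(3)]) auto
  ultimately show ?thesis
    using * assms(4) unfolding test_function_def by metis
qed

text \<open>The factor \<open>m\<close> may be singular at the origin; this is how negative powers of \<open>|x|\<close> enter.\<close>

lemma test_function_times:
  assumes z: "test_function z g"
    and m: "\<And>x. x \<noteq> 0 \<Longrightarrow> (m has_derivative (\<lambda>h. gm x \<bullet> h)) (at x)"
    and gm: "continuous_on (- {0}) gm"
  shows "test_function (\<lambda>x. m x * z x) (\<lambda>x. m x *\<^sub>R g x + z x *\<^sub>R gm x)"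
proof -
  obtain \<epsilon> R where *: "\<epsilon> > 0" "\<And>x. norm x < \<epsilon> \<or> R < norm x \<Longrightarrow> z x = 0"
     "\<And>x. norm x < \<epsilon> \<or> R < norm x \<Longrightarrow> g x = 0"
    using test_function_support[OF z] by metis
  let ?G = "\<lambda>x. m x *\<^sub>R g x + z x *\<^sub>R gm x"
  have "((\<lambda>x. m x * z x) has_derivative (\<lambda>h. ?G x \<bullet> h)) (at x)" for x
  proof (cases "x = 0")
    case True
    have "((\<lambda>x. m x * z x) has_derivative (\<lambda>h. 0)) (at x)"
      by (rule has_derivative_transform_within_open[of "\<lambda>_. 0" _ _ _ "ball 0 \<epsilon>"])
        (use * True in auto)
    then show ?thesis using True * by simp
  next
    case False
    show ?thesis
      by (rule has_derivative_eq_rhs[OF has_derivative_mult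
            [OF m[OF False] test_function_has_derivative[OF z]]])
        (auto simp: algebra_simps)
  qed
  moreover have "continuous_on UNIV ?G"
  proof -
    have "continuous_on (- {0}) m"
      by (rule has_derivative_continuous_on[of _ _ "\<lambda>x h. gm x \<bullet> h"])
        (use m in \<open>auto intro: has_derivative_at_withinI\<close>)
    then have "continuous_on (- {0}) ?G"
      using test_function_continuous[OF z] gm
      by (intro continuous_intros) (auto intro: continuous_on_subset)
    moreover have "continuous_on (ball 0 \<epsilon>) ?G"
      by (rule continuous_on_eq[of _ "\<lambda>_. 0"]) (auto simp: * )
    ultimately have "continuous_on (- {0} \<union> ball 0 \<epsilon>) ?G"
      by (intro continuous_on_open_Un) auto
    moreover have "- {0} \<union> ball 0 \<epsilon> = (UNIV :: 'a set)" using *(1) by auto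
    ultimately show ?thesis by simp
  qed
  ultimately show ?thesis
    using * unfolding test_function_def by (metis mult_zero_right)
qed

section \<open>Integration by parts for Lipschitz functions\<close>

lemma AE_inner_nonzero:
  fixes l :: "'a::euclidean_space"
  assumes "l \<noteq> 0"
  shows "AE x in lborel. l \<bullet> x \<noteq> 0"
proof -
  have "{x. l \<bullet> x = 0} \<in> sets borel" by measurable
  moreover have "{x. l \<bullet> x = 0} \<in> null_sets lebesgue"
    using negligible_hyperplane[of l 0] assms by (simp add: negligible_iff_null_sets)
  ultimately have "{x. l \<bullet> x = 0} \<in> null_sets lborel"
    by (simp add: null_sets_def)
  then show ?thesis by (rule AE_I') auto
qed

text \<open>The difference quotients of \<open>h\<close> have integral zero by translation invariance, and they converge to
the derivative boundedly on a bounded set. A derivative almost everywhere is enough, which allows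
\<open>h = z\<^sup>2/(l \<bullet> x)\<close> below without examining it on the hyperplane.\<close>

lemma integral_directional_derivative:
  fixes h :: "'a::euclidean_space \<Rightarrow> real"
  assumes lip: "\<And>x y. \<bar>h x - h y\<bar> \<le> K * norm (x - y)"
    and supp: "\<And>x. R < norm x \<Longrightarrow> h x = 0"
    and der: "AE x in lborel. (h has_derivative h' x) (at x)"
    and meas [measurable]: "(\<lambda>x. h' x e) \<in> borel_measurable borel"
  shows "integrable lborel (\<lambda>x. h' x e)" "(LINT x|lborel. h' x e) = 0"
proof -
  define t where "t n = 1 / (real n + 1)" for n
  have t: "t n > 0" "t n \<le> 1" for n by (auto simp: t_def)
  have t0: "t \<longlonglongrightarrow> 0" unfolding t_def
    using LIMSEQ_inverse_real_of_nat by (simp add: field_simps add.commute)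
  define q where "q n x = (h (t n *\<^sub>R e + x) - h x) / t n" for n x
  have "continuous_on UNIV h"
  proof (rule continuous_onI)
    fix x and \<eta> :: real assume "\<eta> > 0"
    then have "dist (h y) (h x) \<le> \<eta>" if "dist y x < \<eta> / (\<bar>K\<bar> + 1)" for y
    proof -
      have "\<bar>h y - h x\<bar> \<le> K * norm (y - x)" by (rule lip)
      also have "\<dots> \<le> (\<bar>K\<bar> + 1) * norm (y - x)" by (intro mult_right_mono) auto
      also have "\<dots> \<le> \<eta>" using that by (simp add: dist_norm field_simps)
      finally show ?thesis by (simp add: dist_norm)
    qed
    then show "\<exists>d>0. \<forall>x'\<in>UNIV. dist x' x < d \<longrightarrow> dist (h x') (h x) \<le> \<eta>"
      using \<open>\<eta> > 0\<close> by (intro exI[of _ "\<eta> / (\<bar>K\<bar> + 1)"]) auto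
  qed
  then have h [measurable]: "h \<in> borel_measurable borel"
    by (rule borel_measurable_continuous_onI)
  have int_h: "integrable lborel h"
  proof -
    have "integrable lborel (\<lambda>x. indicator (cball 0 R) x *\<^sub>R h x)"
      using \<open>continuous_on UNIV h\<close>
      by (intro borel_integrable_compact) (auto intro: continuous_on_subset)
    also have "(\<lambda>x. indicator (cball 0 R) x *\<^sub>R h x) = h"
      using supp by (fastforce simp: indicator_def not_le)
    finally show ?thesis .
  qed
  have shift: "integrable lborel (\<lambda>x. h (c + x))" "(LINT x|lborel. h (c + x)) = (LINT x|lborel. h x)"
    for c
  proof -
    have "integrable (distr lborel borel ((+) c)) h" using int_h by (simp add: lborel_distr_plus)
    then show "integrable lborel (\<lambda>x. h (c + x))" by (simp add: integrable_distr_eq)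
    have "(LINT x|distr lborel borel ((+) c). h x) = (LINT x|lborel. h (c + x))"
      by (rule integral_distr) auto
    then show "(LINT x|lborel. h (c + x)) = (LINT x|lborel. h x)" by (simp add: lborel_distr_plus)
  qed
  have q0: "(LINT x|lborel. q n x) = 0" for n
    unfolding q_def using int_h shift[of "t n *\<^sub>R e"] by simp
  define w where "w x = indicator (cball 0 (R + norm e)) x *\<^sub>R (K * norm e)" for x :: 'a
  have w: "integrable lborel w" unfolding w_def
    by (intro borel_integrable_compact) auto
  have bound: "norm (q n x) \<le> w x" for n x
  proof (cases "norm x \<le> R + norm e")
    case True
    have "\<bar>h (t n *\<^sub>R e + x) - h x\<bar> \<le> K * norm (t n *\<^sub>R e + x - x)" by (rule lip)
    then show ?thesis using t[of n] True
      by (simp add: q_def w_def field_simps)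
  next
    case False
    have "norm x \<le> norm (t n *\<^sub>R e + x) + norm (t n *\<^sub>R e)"
      using norm_triangle_ineq4[of "t n *\<^sub>R e + x" "t n *\<^sub>R e"] by simp
    moreover have "norm (t n *\<^sub>R e) \<le> norm e" using t[of n] by (simp add: mult_left_le_one_le)
    ultimately have "R < norm (t n *\<^sub>R e + x)" "R < norm x"
      using False norm_ge_zero[of e] by linarith+
    then show ?thesis using False by (simp add: q_def w_def supp)
  qed
  have lim: "AE x in lborel. (\<lambda>n. q n x) \<longlonglongrightarrow> h' x e"
    using der
  proof eventually_elim
    case (elim x)
    have "((\<lambda>s. (h (x + s *\<^sub>R e) - h x) / s) \<longlongrightarrow> h' x e) (at 0)"
    proof -
      have "((\<lambda>s. h (x + s *\<^sub>R e)) has_derivative (\<lambda>s. h' x (s *\<^sub>R e))) (at 0)"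
        by (rule has_derivative_compose[of "\<lambda>s. x + s *\<^sub>R e" "\<lambda>s. s *\<^sub>R e" 0 UNIV h "h' x"])
          (auto intro!: derivative_eq_intros simp: elim)
      moreover have "(\<lambda>s. h' x (s *\<^sub>R e)) = (*) (h' x e)"
        using has_derivative_bounded_linear[OF elim]
        by (auto simp: linear_simps bounded_linear.linear linear_cmul)
      ultimately have "((\<lambda>s. h (x + s *\<^sub>R e)) has_real_derivative h' x e) (at 0)"
        by (simp add: has_field_derivative_def)
      then show ?thesis by (simp add: has_field_derivative_iff)
    qed
    moreover have "filterlim t (at 0) sequentially"
      using t0 t(1) by (auto simp: filterlim_at less_imp_neq[THEN not_sym] intro!: always_eventually)
    ultimately have "(\<lambda>n. (h (x + t n *\<^sub>R e) - h x) / t n) \<longlonglongrightarrow> h' x e"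
      by (rule filterlim_compose)
    then show ?case by (simp add: q_def add.commute)
  qed
  have mq: "q n \<in> borel_measurable lborel" for n unfolding q_def by measurable
  show "integrable lborel (\<lambda>x. h' x e)"
    by (rule integrable_dominated_convergence[OF _ mq w lim]) (use bound in auto)
  have "(\<lambda>n. LINT x|lborel. q n x) \<longlonglongrightarrow> (LINT x|lborel. h' x e)"
    by (rule integral_dominated_convergence[OF _ mq w lim]) (use bound in auto)
  then show "(LINT x|lborel. h' x e) = 0"
    using LIMSEQ_unique tendsto_const unfolding q0 by blast
qed

section \<open>The Hardy inequality for functions odd under reflections\<close>

definition reflection :: "'a::euclidean_space \<Rightarrow> 'a \<Rightarrow> 'a" where
  "reflection l x = x - (2 * (l \<bullet> x) / (l \<bullet> l)) *\<^sub>R l"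

text \<open>Compare \<open>z\<close> at \<open>x\<close> and at its mirror image, which lie at distance \<open>2 |l \<bullet> x| / |l|\<close>.\<close>

lemma reflection_odd_bound:
  assumes "test_function z g" "l \<noteq> 0" "\<And>x. z (reflection l x) = - z x"
  obtains K where "\<And>x. \<bar>z x\<bar> \<le> K * \<bar>l \<bullet> x\<bar>"
proof -
  obtain K where K: "K > 0" "\<And>x y. \<bar>z x - z y\<bar> \<le> K * norm (x - y)"
    using test_function_lipschitz[OF assms(1)] by metis
  have "\<bar>z x\<bar> \<le> K / norm l * \<bar>l \<bullet> x\<bar>" for x
  proof -
    have "2 * \<bar>z x\<bar> = \<bar>z x - z (reflection l x)\<bar>" using assms(3) by simp
    also have "\<dots> \<le> K * norm (x - reflection l x)" by (rule K)
    also have "norm (x - reflection l x) = 2 * \<bar>l \<bullet> x\<bar> / norm l"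
      using assms(2) by (simp add: reflection_def dot_square_norm power2_eq_square)
    finally show ?thesis using assms(2) by (simp add: field_simps)
  qed
  then show ?thesis by (rule that)
qed

text \<open>The quotients \<open>z x / (l \<bullet> x)\<close> are bounded, and the difference of the two values is a polynomial in
these quotients and in differences of \<open>z\<close> and of \<open>l\<close>. Since \<open>z\<close> vanishes on the hyperplane, the
convention \<open>0/0 = 0\<close> gives the continuous extension across it.\<close>

lemma square_quotient_lipschitz:
  fixes z :: "'a::euclidean_space \<Rightarrow> real"
  assumes lip: "\<And>x y. \<bar>z x - z y\<bar> \<le> K * norm (x - y)" and lin: "\<And>x. \<bar>z x\<bar> \<le> C * \<bar>l \<bullet> x\<bar>"
  shows "\<bar>(z x)\<^sup>2 / (l \<bullet> x) - (z y)\<^sup>2 / (l \<bullet> y)\<bar> \<le> (2 * \<bar>C\<bar> * K + C\<^sup>2 * norm l) * norm (x - y)"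
proof -
  define a b where "a = z x / (l \<bullet> x)" and "b = z y / (l \<bullet> y)"
  have zero: "l \<bullet> w = 0 \<Longrightarrow> z w = 0" for w using lin[of w] by simp
  have C: "\<bar>z w / (l \<bullet> w)\<bar> \<le> \<bar>C\<bar>" for w
  proof -
    have "\<bar>z w\<bar> \<le> \<bar>C\<bar> * \<bar>l \<bullet> w\<bar>"
      using lin[of w] mult_right_mono[OF abs_ge_self[of C] abs_ge_zero[of "l \<bullet> w"]] by linarith
    then show ?thesis by (cases "l \<bullet> w = 0") (auto simp: field_simps)
  qed
  have "(z x)\<^sup>2 / (l \<bullet> x) - (z y)\<^sup>2 / (l \<bullet> y) =
      a * (z x - z y) + b * (z x - z y) + (a * b) * (l \<bullet> (y - x))"
    using zero[of x] zero[of y] unfolding a_def b_def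
    by (cases "l \<bullet> x = 0"; cases "l \<bullet> y = 0") (simp_all add: inner_diff_right field_simps power2_eq_square)
  also have "\<bar>\<dots>\<bar> \<le> \<bar>a\<bar> * \<bar>z x - z y\<bar> + \<bar>b\<bar> * \<bar>z x - z y\<bar> + \<bar>a * b\<bar> * \<bar>l \<bullet> (y - x)\<bar>"
    by (simp add: abs_mult[symmetric])
  also have "\<dots> \<le> \<bar>C\<bar> * (K * norm (x - y)) + \<bar>C\<bar> * (K * norm (x - y)) + (\<bar>C\<bar> * \<bar>C\<bar>) * (norm l * norm (x - y))"
    using C[of x] C[of y] lip[of x y] Cauchy_Schwarz_ineq2[of l "y - x"]
    unfolding a_def[symmetric] b_def[symmetric] abs_mult
    by (intro add_mono mult_mono) (auto simp: norm_minus_commute)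
  also have "\<dots> = (2 * \<bar>C\<bar> * K + C\<^sup>2 * norm l) * norm (x - y)"
    by (simp add: algebra_simps power2_eq_square)
  finally show ?thesis .
qed

text \<open>The integrand is the derivative of \<open>z\<^sup>2/(l \<bullet> x)\<close> in direction \<open>l\<close>.\<close>

lemma integral_root_term:
  assumes z: "test_function z g" and l: "l \<noteq> 0" "\<And>x. z (reflection l x) = - z x"
  defines "F \<equiv> (\<lambda>x. 2 * z x * (g x \<bullet> l) / (l \<bullet> x) - (z x)\<^sup>2 * (l \<bullet> l) / (l \<bullet> x)\<^sup>2)"
  shows "integrable lborel F" "(LINT x|lborel. F x) = 0"
proof -
  obtain K where K: "\<And>x y. \<bar>z x - z y\<bar> \<le> K * norm (x - y)"
    using test_function_lipschitz[OF z] by metis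
  obtain C where C: "\<And>x. \<bar>z x\<bar> \<le> C * \<bar>l \<bullet> x\<bar>" using reflection_odd_bound[OF z l] by metis
  obtain R where R: "\<And>x. R < norm x \<Longrightarrow> z x = 0" using test_function_support[OF z] by metis
  note [measurable] = test_function_borel[OF z]
  define h' where "h' = (\<lambda>x v. 2 * z x * (g x \<bullet> v) / (l \<bullet> x) - (z x)\<^sup>2 * (l \<bullet> v) / (l \<bullet> x)\<^sup>2)"
  have "AE x in lborel. ((\<lambda>x. (z x)\<^sup>2 / (l \<bullet> x)) has_derivative h' x) (at x)"
    using AE_inner_nonzero[OF l(1)]
  proof eventually_elim
    case (elim x)
    then show ?case unfolding h'_def
      by (auto intro!: derivative_eq_intros test_function_has_derivative[OF z]
          simp: field_simps power2_eq_square)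
  qed
  then have "integrable lborel (\<lambda>x. h' x l)" "(LINT x|lborel. h' x l) = 0"
    using integral_directional_derivative[OF square_quotient_lipschitz[OF K C], of R h' l]
    by (auto simp: R h'_def)
  then show "integrable lborel F" "(LINT x|lborel. F x) = 0" by (simp_all add: F_def h'_def)
qed

lemma integral_gradient:
  assumes z: "test_function z g"
  shows "integrable lborel (\<lambda>x. g x \<bullet> e)" "(LINT x|lborel. g x \<bullet> e) = 0"
proof -
  obtain K where K: "\<And>x y. \<bar>z x - z y\<bar> \<le> K * norm (x - y)"
    using test_function_lipschitz[OF z] by metis
  obtain R where R: "\<And>x. R < norm x \<Longrightarrow> z x = 0" using test_function_support[OF z] by metis
  note [measurable] = test_function_borel[OF z]
  show "integrable lborel (\<lambda>x. g x \<bullet> e)" "(LINT x|lborel. g x \<bullet> e) = 0"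
    using integral_directional_derivative[OF K, of R "\<lambda>x h. g x \<bullet> h" e]
    by (auto simp: R test_function_has_derivative[OF z])
qed

text \<open>The integrand is the divergence of the vector field \<open>z\<^sup>2 x/|x|\<^sup>2\<close>.\<close>

lemma integral_radial_term:
  fixes z :: "'a::euclidean_space \<Rightarrow> real"
  assumes z: "test_function z g"
  defines "F \<equiv> (\<lambda>x. 2 * z x * (g x \<bullet> x) / (x \<bullet> x) + (real DIM('a) - 2) * (z x)\<^sup>2 / (x \<bullet> x))"
  shows "integrable lborel F" "(LINT x|lborel. F x) = 0"
proof -
  have sq: "test_function (\<lambda>x. (z x)\<^sup>2) (\<lambda>x. (2 * z x) *\<^sub>R g x)"
    by (rule test_function_compose[OF z])
      (auto intro!: derivative_eq_intros continuous_intros)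
  define m where "m b x = (x \<bullet> b) / (x \<bullet> x)" for b x :: 'a
  define gm where "gm b x = (1 / (x \<bullet> x)) *\<^sub>R b - (2 * (x \<bullet> b) / (x \<bullet> x)\<^sup>2) *\<^sub>R x" for b x :: 'a
  define G where "G b x = m b x *\<^sub>R ((2 * z x) *\<^sub>R g x) + (z x)\<^sup>2 *\<^sub>R gm b x" for b x
  have test: "test_function (\<lambda>x. m b x * (z x)\<^sup>2) (G b)" for b
    unfolding G_def
  proof (rule test_function_times[OF sq])
    show "(m b has_derivative (\<lambda>h. gm b x \<bullet> h)) (at x)" if "x \<noteq> 0" for x
      unfolding m_def gm_def using that
      by (auto intro!: derivative_eq_intros ext
          simp: field_simps power2_eq_square inner_commute algebra_simps)
    show "continuous_on (- {0}) (gm b)"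
      unfolding gm_def by (intro continuous_intros) auto
  qed
  have eq: "F x = (\<Sum>b\<in>Basis. G b x \<bullet> b)" for x
  proof (cases "x = 0")
    case True
    then show ?thesis by (simp add: F_def G_def m_def gm_def)
  next
    case False
    have "(\<Sum>b\<in>Basis. G b x \<bullet> b) =
        (\<Sum>b\<in>Basis. 2 * z x / (x \<bullet> x) * ((g x \<bullet> b) * (x \<bullet> b)) + (z x)\<^sup>2 / (x \<bullet> x)
            - 2 * (z x)\<^sup>2 / (x \<bullet> x)\<^sup>2 * ((x \<bullet> b) * (x \<bullet> b)))"
      by (rule sum.cong) (simp_all add: G_def m_def gm_def algebra_simps)
    also have "\<dots> = 2 * z x / (x \<bullet> x) * (g x \<bullet> x) + real DIM('a) * ((z x)\<^sup>2 / (x \<bullet> x))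
            - 2 * (z x)\<^sup>2 / (x \<bullet> x)\<^sup>2 * (x \<bullet> x)"
      by (simp only: sum.distrib sum_subtractf sum_distrib_left[symmetric]
          euclidean_inner[of "g x" x, symmetric] euclidean_inner[of x x, symmetric] sum_constant)
    also have "\<dots> = F x" using False by (simp add: F_def field_simps power2_eq_square)
    finally show ?thesis by simp
  qed
  show "integrable lborel F" unfolding eq[abs_def]
    by (intro Bochner_Integration.integrable_sum integral_gradient[OF test])
  show "(LINT x|lborel. F x) = 0"
    unfolding eq by (subst Bochner_Integration.integral_sum) (auto simp: integral_gradient[OF test])
qed

lemma integrable_gradient_square:
  assumes "test_function z g"
  shows "integrable lborel (\<lambda>x. g x \<bullet> g x)"
proof -
  obtain \<epsilon> R where "\<epsilon> > 0" "\<And>x. norm x < \<epsilon> \<or> R < norm x \<Longrightarrow> g x = 0"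
    using test_function_support[OF assms] by metis
  then show ?thesis
    using test_function_continuous[OF assms]
    by (intro integrable_annulus[of _ \<epsilon> R]) (auto intro!: continuous_intros intro: continuous_on_subset)
qed

lemma integrable_hardy_weight:
  assumes "test_function z g"
  shows "integrable lborel (\<lambda>x. (z x)\<^sup>2 / (x \<bullet> x))"
proof -
  obtain \<epsilon> R where "\<epsilon> > 0" "\<And>x. norm x < \<epsilon> \<or> R < norm x \<Longrightarrow> z x = 0"
    using test_function_support[OF assms] by metis
  then show ?thesis
    using test_function_continuous[OF assms]
    by (intro integrable_annulus[of _ \<epsilon> R]) (auto intro!: continuous_intros intro: continuous_on_subset)
qed

text \<open>The ground state argument, with \<open>L\<close> the logarithmic gradient of the product \<open>P\<close> of the
\<open>|l \<bullet> x|\<^sup>c\<close>. As \<open>div L = - (\<Sum>l\<in>\<Phi>. c |l|\<^sup>2/(l \<bullet> x)\<^sup>2)\<close> and \<open>\<Delta>P/P = div L + |L|\<^sup>2\<close>, the last hypothesis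
says that \<open>P\<close> is harmonic. Any \<open>c\<close> is admitted so that \<open>\<Phi>\<close> may contain both \<open>l\<close> and \<open>-l\<close>,
each with half the exponent.\<close>

lemma hardy_root_system:
  fixes z :: "'a::euclidean_space \<Rightarrow> real"
  assumes z: "test_function z g"
    and "finite \<Phi>" and roots: "\<And>l. l \<in> \<Phi> \<Longrightarrow> l \<noteq> 0" "\<And>l x. l \<in> \<Phi> \<Longrightarrow> z (reflection l x) = - z x"
    and harmonic: "\<And>x. (\<forall>l\<in>\<Phi>. l \<bullet> x \<noteq> 0) \<Longrightarrow>
      (norm (\<Sum>l\<in>\<Phi>. (c / (l \<bullet> x)) *\<^sub>R l))\<^sup>2 = (\<Sum>l\<in>\<Phi>. c * (l \<bullet> l) / (l \<bullet> x)\<^sup>2)"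
  shows "(LINT x|lborel. g x \<bullet> g x) \<ge>
    (c * real (card \<Phi>) + (real DIM('a) - 2) / 2)\<^sup>2 * (LINT x|lborel. (z x)\<^sup>2 / (x \<bullet> x))"
proof -
  define D where "D = c * real (card \<Phi>)"
  define e where "e = D + (real DIM('a) - 2) / 2"
  define L where "L x = (\<Sum>l\<in>\<Phi>. (c / (l \<bullet> x)) *\<^sub>R l)" for x
  define rad where "rad x = 2 * z x * (g x \<bullet> x) / (x \<bullet> x) + (real DIM('a) - 2) * (z x)\<^sup>2 / (x \<bullet> x)" for x
  define rt where "rt l x = 2 * z x * (g x \<bullet> l) / (l \<bullet> x) - (z x)\<^sup>2 * (l \<bullet> l) / (l \<bullet> x)\<^sup>2" for l x
  \<comment> \<open>\<open>T\<close> is the divergence of the field \<open>z\<^sup>2 \<nabla>\<phi>/\<phi>\<close>, where \<open>\<nabla>\<phi>/\<phi> = L - e x/|x|\<^sup>2\<close>.\<close>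
  define T where "T x = (\<Sum>l\<in>\<Phi>. c * rt l x) - e * rad x" for x
  note rad = integral_radial_term[OF z, folded rad_def]
  have rt: "integrable lborel (rt l)" "(LINT x|lborel. rt l x) = 0" if "l \<in> \<Phi>" for l
    using integral_root_term[OF z roots[OF that]] that
    unfolding rt_def[abs_def] by (auto simp: that)
  have T: "integrable lborel T" "(LINT x|lborel. T x) = 0"
  proof -
    show "integrable lborel T" unfolding T_def
      by (intro Bochner_Integration.integrable_diff Bochner_Integration.integrable_sum
          integrable_mult_right rt rad)
    have "(LINT x|lborel. T x) =
        (LINT x|lborel. (\<Sum>l\<in>\<Phi>. c * rt l x)) - (LINT x|lborel. e * rad x)"
      unfolding T_def using rt rad
      by (intro Bochner_Integration.integral_diff Bochner_Integration.integrable_sum) auto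
    also have "\<dots> = (\<Sum>l\<in>\<Phi>. (LINT x|lborel. c * rt l x)) - (LINT x|lborel. e * rad x)"
      using rt by (subst Bochner_Integration.integral_sum) auto
    also have "\<dots> = 0" using rt rad by simp
    finally show "(LINT x|lborel. T x) = 0" .
  qed
  have "AE x in lborel. \<forall>l\<in>\<Phi>. l \<bullet> x \<noteq> 0"
    using roots(1) \<open>finite \<Phi>\<close> by (subst AE_finite_all) (auto intro: AE_inner_nonzero)
  then have "AE x in lborel. T x + e\<^sup>2 * ((z x)\<^sup>2 / (x \<bullet> x)) \<le> g x \<bullet> g x"
  proof eventually_elim
    case (elim x)
    define r where "r = 1 / (x \<bullet> x)"
    \<comment> \<open>Euler's relation for the homogeneous function \<open>P\<close>.\<close>
    have Lx: "L x \<bullet> x = D" using elim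
      by (simp add: L_def D_def inner_sum_left)
    have Tx: "T x = 2 * z x * (g x \<bullet> L x) - (z x)\<^sup>2 * (L x \<bullet> L x) - e * rad x"
    proof -
      have "(\<Sum>l\<in>\<Phi>. c * rt l x) =
          2 * z x * (\<Sum>l\<in>\<Phi>. (c / (l \<bullet> x)) * (g x \<bullet> l)) - (z x)\<^sup>2 * (\<Sum>l\<in>\<Phi>. c * (l \<bullet> l) / (l \<bullet> x)\<^sup>2)"
        by (simp add: rt_def sum_distrib_left sum_subtractf[symmetric] algebra_simps)
      also have "(\<Sum>l\<in>\<Phi>. (c / (l \<bullet> x)) * (g x \<bullet> l)) = g x \<bullet> L x"
        by (simp add: L_def inner_sum_right)
      also have "(\<Sum>l\<in>\<Phi>. c * (l \<bullet> l) / (l \<bullet> x)\<^sup>2) = L x \<bullet> L x"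
        using harmonic[OF elim] by (simp add: L_def power2_norm_eq_inner)
      finally show ?thesis by (simp add: T_def)
    qed
    have rr: "r * r * (x \<bullet> x) = r" by (simp add: r_def)
    have rdx: "rad x = 2 * z x * (g x \<bullet> x) * r + (real DIM('a) - 2) * (z x)\<^sup>2 * r"
      by (simp add: rad_def r_def)
    \<comment> \<open>The square \<open>|\<nabla>z - z \<nabla>\<phi>/\<phi>|\<^sup>2\<close>.\<close>
    have "0 \<le> (g x + (e * z x * r) *\<^sub>R x - z x *\<^sub>R L x) \<bullet> (g x + (e * z x * r) *\<^sub>R x - z x *\<^sub>R L x)"
      by simp
    also have "\<dots> = g x \<bullet> g x + e\<^sup>2 * (z x)\<^sup>2 * (r * r * (x \<bullet> x)) + (z x)\<^sup>2 * (L x \<bullet> L x)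
        + 2 * e * z x * r * (g x \<bullet> x) - 2 * z x * (g x \<bullet> L x) - 2 * e * (z x)\<^sup>2 * r * (L x \<bullet> x)"
      by (simp add: inner_add_left inner_add_right inner_diff_left inner_diff_right
          inner_commute[of x "g x"] inner_commute[of x "L x"] inner_commute[of "L x" "g x"]
          algebra_simps power2_eq_square)
    also have "\<dots> = g x \<bullet> g x - T x - e\<^sup>2 * (z x)\<^sup>2 * r"
    proof -
      have d: "real DIM('a) = 2 * (e - D) + 2" by (simp add: e_def field_simps)
      show ?thesis unfolding Tx rr Lx rdx d by (simp add: algebra_simps power2_eq_square)
    qed
    finally show ?case by (simp add: r_def)
  qed
  moreover have "integrable lborel (\<lambda>x. T x + e\<^sup>2 * ((z x)\<^sup>2 / (x \<bullet> x)))"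
    by (intro Bochner_Integration.integrable_add integrable_mult_right T integrable_hardy_weight[OF z])
  ultimately have "(LINT x|lborel. T x + e\<^sup>2 * ((z x)\<^sup>2 / (x \<bullet> x))) \<le> (LINT x|lborel. g x \<bullet> g x)"
    by (intro integral_mono_AE integrable_gradient_square[OF z])
  also have "(LINT x|lborel. T x + e\<^sup>2 * ((z x)\<^sup>2 / (x \<bullet> x))) = e\<^sup>2 * (LINT x|lborel. (z x)\<^sup>2 / (x \<bullet> x))"
    using T integrable_hardy_weight[OF z]
    by (subst Bochner_Integration.integral_add) (auto simp del: times_divide_eq_right)
  finally show ?thesis by (simp add: e_def D_def)
qed

text \<open>A linear function is harmonic of degree one.\<close>

lemma hardy_single_root:
  fixes z :: "'a::euclidean_space \<Rightarrow> real"
  assumes "test_function z g" "b \<noteq> 0" "\<And>x. z (reflection b x) = - z x"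
  shows "(LINT x|lborel. g x \<bullet> g x) \<ge> (real DIM('a) / 2)\<^sup>2 * (LINT x|lborel. (z x)\<^sup>2 / (x \<bullet> x))"
proof -
  have "(LINT x|lborel. g x \<bullet> g x) \<ge>
    (1 * real (card {b}) + (real DIM('a) - 2) / 2)\<^sup>2 * (LINT x|lborel. (z x)\<^sup>2 / (x \<bullet> x))"
  proof (rule hardy_root_system[OF assms(1)])
    fix x assume "\<forall>l\<in>{b}. l \<bullet> x \<noteq> 0"
    then show "(norm (\<Sum>l\<in>{b}. (1 / (l \<bullet> x)) *\<^sub>R l))\<^sup>2 = (\<Sum>l\<in>{b}. 1 * (l \<bullet> l) / (l \<bullet> x)\<^sup>2)"
      by (simp add: power_mult_distrib power_divide dot_square_norm)
  qed (use assms in auto)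
  also have "1 * real (card {b}) + (real DIM('a) - 2) / 2 = real DIM('a) / 2"
    by (simp add: field_simps)
  finally show ?thesis .
qed

section \<open>Antisymmetric functions\<close>

text \<open>Harmonicity of the Vandermonde product. The mixed terms cancel because
\<open>1/((a-b)(a-c)) + 1/((b-c)(b-a)) + 1/((c-a)(c-b)) = 0\<close> for distinct \<open>a\<close>, \<open>b\<close>, \<open>c\<close>. The diagonal terms
\<open>1/0 = 0\<close> drop out, so the sums may run over all indices.\<close>

lemma sum_reciprocal_differences_square:
  fixes x :: "'i::finite \<Rightarrow> real"
  assumes "inj x"
  shows "(\<Sum>i\<in>UNIV. (\<Sum>j\<in>UNIV. 1 / (x i - x j))\<^sup>2) = (\<Sum>i\<in>UNIV. \<Sum>j\<in>UNIV. (1 / (x i - x j))\<^sup>2)"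
proof -
  define t where "t i j = 1 / (x i - x j)" for i j
  define a where "a i j k = (if j = k then 0 else t i j * t i k)" for i j k
  \<comment> \<open>Summing a mixed term over its cyclic permutations gives zero.\<close>
  have cyc: "a i j k + a j k i + a k i j = 0" for i j k
  proof (cases "i = j \<or> j = k \<or> k = i")
    case True
    then show ?thesis by (auto simp: a_def t_def)
  next
    case False
    then have "x i - x j \<noteq> 0" "x j - x k \<noteq> 0" "x k - x i \<noteq> 0" "x i - x k \<noteq> 0" "x j - x i \<noteq> 0" "x k - x j \<noteq> 0"
      using assms by (auto dest: injD)
    then have "t i j * t i k + t j k * t j i + t k i * t k j = 0"
      unfolding t_def by (simp add: divide_simps) (simp add: algebra_simps)
    with False show ?thesis by (auto simp: a_def)
  qed
  define A where "A = (\<Sum>i\<in>UNIV. \<Sum>j\<in>UNIV. \<Sum>k\<in>UNIV. a i j k)"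
  have "(\<Sum>i\<in>UNIV. \<Sum>j\<in>UNIV. \<Sum>k\<in>UNIV. a j k i) = A"
  proof -
    have "(\<Sum>i\<in>UNIV. \<Sum>j\<in>UNIV. \<Sum>k\<in>UNIV. a j k i) = (\<Sum>j\<in>UNIV. \<Sum>i\<in>UNIV. \<Sum>k\<in>UNIV. a j k i)"
      by (rule sum.swap)
    also have "\<dots> = A" unfolding A_def by (intro sum.cong refl sum.swap)
    finally show ?thesis .
  qed
  moreover have "(\<Sum>i\<in>UNIV. \<Sum>j\<in>UNIV. \<Sum>k\<in>UNIV. a k i j) = A"
  proof -
    have "(\<Sum>i\<in>UNIV. \<Sum>j\<in>UNIV. \<Sum>k\<in>UNIV. a k i j) = (\<Sum>i\<in>UNIV. \<Sum>k\<in>UNIV. \<Sum>j\<in>UNIV. a k i j)"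
      by (intro sum.cong refl sum.swap)
    also have "\<dots> = A" unfolding A_def by (rule sum.swap)
    finally show ?thesis .
  qed
  moreover have "(\<Sum>i\<in>UNIV. \<Sum>j\<in>UNIV. \<Sum>k\<in>UNIV. a i j k + a j k i + a k i j) = 0"
    by (simp add: cyc)
  ultimately have "A = 0"
    unfolding sum.distrib by (simp add: A_def)
  have "(\<Sum>j\<in>UNIV. t i j)\<^sup>2 = (\<Sum>j\<in>UNIV. (t i j)\<^sup>2) + (\<Sum>j\<in>UNIV. \<Sum>k\<in>UNIV. a i j k)" for i
  proof -
    have "(\<Sum>j\<in>UNIV. t i j)\<^sup>2 = (\<Sum>j\<in>UNIV. \<Sum>k\<in>UNIV. t i j * t i k)"
      by (simp add: power2_eq_square sum_product)
    also have "\<dots> = (\<Sum>j\<in>UNIV. \<Sum>k\<in>UNIV. (if j = k then (t i j)\<^sup>2 else 0) + a i j k)"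
      by (intro sum.cong refl) (auto simp: a_def power2_eq_square)
    finally show ?thesis by (simp add: sum.distrib)
  qed
  then have "(\<Sum>i\<in>UNIV. (\<Sum>j\<in>UNIV. t i j)\<^sup>2) = (\<Sum>i\<in>UNIV. \<Sum>j\<in>UNIV. (t i j)\<^sup>2) + A"
    by (simp add: sum.distrib A_def)
  with \<open>A = 0\<close> show ?thesis by (simp add: t_def)
qed

text \<open>A transposition of coordinates is an orthogonal reflection.\<close>

lemma reflection_axis_difference:
  fixes x :: "real ^ 'n"
  assumes "i \<noteq> j"
  shows "reflection (axis i 1 - axis j 1) x = (\<chi> k. x $ Transposition.transpose i j k)"
proof -
  have "(axis i 1 - axis j 1) \<bullet> (axis i 1 - axis j (1::real)) = (2::real)"
    using assms by (simp add: inner_diff_left inner_diff_right inner_axis_axis)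
  moreover have "(axis i 1 - axis j 1) \<bullet> x = x $ i - x $ j"
    by (simp add: inner_diff_left inner_axis')
  ultimately have "reflection (axis i 1 - axis j 1) x = x - (x $ i - x $ j) *\<^sub>R (axis i 1 - axis j 1)"
    by (simp add: reflection_def)
  then show ?thesis using assms
    by (auto simp: vec_eq_iff axis_def Transposition.transpose_def)
qed

text \<open>The index type carries no order, so all roots \<open>e\<^sub>i - e\<^sub>j\<close> with \<open>i \<noteq> j\<close> are taken, each hyperplane twice,
with exponent one half.\<close>

lemma hardy_antisymmetric:
  fixes z :: "real ^ 'n \<Rightarrow> real"
  assumes z: "test_function z g" and anti: "antisymmetric z"
  shows "(LINT x|lborel. g x \<bullet> g x) \<ge>
    (((real CARD('n))\<^sup>2 - 2) / 2)\<^sup>2 * (LINT x|lborel. (z x)\<^sup>2 / (x \<bullet> x))"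
proof -
  define P where "P = {(i, j). i \<noteq> (j :: 'n)}"
  define root :: "'n \<times> 'n \<Rightarrow> real ^ 'n" where "root = (\<lambda>(i, j). axis i 1 - axis j 1)"
  have comp: "root (i, j) $ k = (if k = i then 1 else 0) - (if k = j then 1 else 0)" for i j k
    by (auto simp: root_def axis_def)
  have nz: "root q \<noteq> 0" if "q \<in> P" for q
    using that comp[of "fst q" "snd q" "fst q"] by (auto simp: P_def)
  have "inj_on root P"
  proof (rule inj_onI)
    fix q q' assume q: "q \<in> P" "q' \<in> P" "root q = root q'"
    obtain i j i' j' where [simp]: "q = (i, j)" "q' = (i', j')" by fastforce
    have "root (i, j) $ k = root (i', j') $ k" for k using q by simp
    from this[of i] this[of j] show "q = q'"
      using q by (auto simp: comp P_def split: if_splits)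
  qed
  have split: "(\<Sum>q\<in>P. f q) = (\<Sum>i\<in>UNIV. \<Sum>j\<in>UNIV. if i = j then 0 else f (i, j))" for f :: "_ \<Rightarrow> real"
  proof -
    have "(\<Sum>q\<in>P. f q) = (\<Sum>q\<in>UNIV. if fst q = snd q then 0 else f q)"
      by (intro sum.mono_neutral_cong_left) (auto simp: P_def)
    also have "\<dots> = (\<Sum>i\<in>UNIV. \<Sum>j\<in>UNIV. if i = j then 0 else f (i, j))"
      by (simp add: UNIV_Times_UNIV[symmetric] sum.cartesian_product case_prod_unfold
          del: UNIV_Times_UNIV cong: if_cong)
    finally show ?thesis .
  qed
  have card: "real (card (root ` P)) = (real CARD('n))\<^sup>2 - real CARD('n)"
  proof -
    have "real (card (root ` P)) = (\<Sum>q\<in>P. 1)"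
      using card_image[OF \<open>inj_on root P\<close>] by simp
    also have "\<dots> = (\<Sum>i\<in>(UNIV::'n set). \<Sum>j\<in>(UNIV::'n set). 1 - (if i = j then 1 else 0))"
      unfolding split by (intro sum.cong) auto
    also have "\<dots> = (real CARD('n))\<^sup>2 - real CARD('n)"
      by (simp add: sum_subtractf power2_eq_square algebra_simps)
    finally show ?thesis .
  qed
  have "(LINT x|lborel. g x \<bullet> g x) \<ge>
    (1 / 2 * real (card (root ` P)) + (real DIM(real ^ 'n) - 2) / 2)\<^sup>2 * (LINT x|lborel. (z x)\<^sup>2 / (x \<bullet> x))"
  proof (rule hardy_root_system[OF z])
    show "finite (root ` P)" by simp
    show "l \<noteq> 0" if "l \<in> root ` P" for l using that nz by auto
    show "z (reflection l x) = - z x" if "l \<in> root ` P" for l x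
      using that anti by (auto simp: root_def P_def reflection_axis_difference antisymmetric_def)
    fix x assume x: "\<forall>l\<in>root ` P. l \<bullet> x \<noteq> 0"
    have rx: "root (i, j) \<bullet> x = x $ i - x $ j" for i j
      by (simp add: root_def inner_diff_left inner_axis')
    have "inj (($) x)"
    proof (rule injI, rule ccontr)
      fix i j assume "x $ i = x $ j" "i \<noteq> j"
      then have "(i, j) \<in> P" by (simp add: P_def)
      then show False using x rx[of i j] \<open>x $ i = x $ j\<close> by auto
    qed
    have "(\<Sum>l\<in>root ` P. (1 / 2 / (l \<bullet> x)) *\<^sub>R l) $ k = (\<Sum>j\<in>UNIV. 1 / (x $ k - x $ j))" for k
    proof -
      have "(\<Sum>l\<in>root ` P. (1 / 2 / (l \<bullet> x)) *\<^sub>R l) $ k = (\<Sum>q\<in>P. 1 / 2 / (root q \<bullet> x) * root q $ k)"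
        by (simp add: sum.reindex[OF \<open>inj_on root P\<close>])
      also have "\<dots> = (\<Sum>i\<in>UNIV. \<Sum>j\<in>UNIV. (if k = i then 1 / 2 / (x $ i - x $ j) else 0)
            - (if k = j then 1 / 2 / (x $ i - x $ j) else 0))"
        unfolding split by (intro sum.cong) (auto simp: rx comp)
      also have "\<dots> = (\<Sum>j\<in>UNIV. 1 / 2 / (x $ k - x $ j)) - (\<Sum>i\<in>UNIV. 1 / 2 / (x $ i - x $ k))"
      proof -
        have "(\<Sum>i\<in>UNIV. \<Sum>j\<in>UNIV. if k = i then 1 / 2 / (x $ i - x $ j) else 0)
            = (\<Sum>i\<in>UNIV. if k = i then \<Sum>j\<in>UNIV. 1 / 2 / (x $ i - x $ j) else 0)"
          by (intro sum.cong) auto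
        then show ?thesis by (simp add: sum_subtractf)
      qed
      also have "\<dots> = (\<Sum>j\<in>UNIV. 1 / (x $ k - x $ j))"
      proof -
        have "1 / 2 / (x $ k - x $ j) - 1 / 2 / (x $ j - x $ k) = 1 / (x $ k - x $ j)" for j
        proof -
          have "1 / 2 / (x $ j - x $ k) = - (1 / 2 / (x $ k - x $ j))"
            by (subst minus_diff_eq[symmetric]) (simp only: divide_minus_right)
          moreover have "1 / 2 / d + 1 / 2 / d = 1 / d" for d :: real
            by (cases "d = 0") (simp_all add: field_simps)
          ultimately show ?thesis by (simp only: diff_minus_eq_add)
        qed
        then show ?thesis by (simp only: sum_subtractf[symmetric])
      qed
      finally show ?thesis .
    qed
    then have "(norm (\<Sum>l\<in>root ` P. (1 / 2 / (l \<bullet> x)) *\<^sub>R l))\<^sup>2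
        = (\<Sum>k\<in>UNIV. (\<Sum>j\<in>UNIV. 1 / (x $ k - x $ j))\<^sup>2)"
      unfolding power2_norm_eq_inner by (subst inner_vec_def) (simp only: inner_real_def power2_eq_square)
    also have "\<dots> = (\<Sum>i\<in>UNIV. \<Sum>j\<in>UNIV. (1 / (x $ i - x $ j))\<^sup>2)"
      by (rule sum_reciprocal_differences_square[OF \<open>inj (($) x)\<close>])
    also have "\<dots> = (\<Sum>q\<in>P. 1 / 2 * (root q \<bullet> root q) / (root q \<bullet> x)\<^sup>2)"
      unfolding split rx
      by (intro sum.cong refl)
        (auto simp: root_def inner_diff_left inner_diff_right inner_axis_axis power_divide)
    also have "\<dots> = (\<Sum>l\<in>root ` P. 1 / 2 * (l \<bullet> l) / (l \<bullet> x)\<^sup>2)"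
      by (simp add: sum.reindex[OF \<open>inj_on root P\<close>])
    finally show "(norm (\<Sum>l\<in>root ` P. (1 / 2 / (l \<bullet> x)) *\<^sub>R l))\<^sup>2 = (\<Sum>l\<in>root ` P. 1 / 2 * (l \<bullet> l) / (l \<bullet> x)\<^sup>2)" .
  qed
  also have "1 / 2 * real (card (root ` P)) + (real DIM(real ^ 'n) - 2) / 2 = ((real CARD('n))\<^sup>2 - 2) / 2"
    by (simp add: card field_simps)
  finally show ?thesis .
qed

section \<open>Odd functions\<close>

lemma reflection_self_adjoint: "x \<bullet> reflection l y = reflection l x \<bullet> y"
  by (simp add: reflection_def inner_diff_left inner_diff_right inner_commute)

lemma reflection_involution: "reflection l (reflection l x) = x"
  by (cases "l = 0") (simp_all add: reflection_def inner_diff_right algebra_simps)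

lemma inner_reflection_reflection: "reflection l x \<bullet> reflection l y = x \<bullet> y"
  using reflection_self_adjoint[of "reflection l x" l y] by (simp add: reflection_involution)

lemma norm_reflection: "norm (reflection l x) = norm x"
  by (simp add: norm_eq_sqrt_inner inner_reflection_reflection)

lemma continuous_reflection: "continuous_on S (reflection l)"
  unfolding reflection_def[abs_def] divide_inverse by (intro continuous_intros)

lemma reflection_uminus: "reflection l (- x) = - reflection l x"
  by (simp add: reflection_def)

lemma lborel_integral_reflection:
  fixes F :: "'a::euclidean_space \<Rightarrow> real"
  assumes b: "b \<in> Basis" and [measurable]: "F \<in> borel_measurable borel"
  shows "(LINT x|lborel. F (reflection b x)) = (LINT x|lborel. F x)"
proof -
  define c where "c j = (if j = b then -1 else 1 :: real)" for j
  have T: "(\<lambda>x. 0 + (\<Sum>j\<in>Basis. (c j * (x \<bullet> j)) *\<^sub>R j)) = reflection b"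
  proof
    fix x
    have "(\<Sum>j\<in>Basis. (c j * (x \<bullet> j)) *\<^sub>R j) =
        (\<Sum>j\<in>Basis. (x \<bullet> j) *\<^sub>R j - (if j = b then (2 * (b \<bullet> x)) *\<^sub>R b else 0))"
      by (intro sum.cong) (auto simp: c_def inner_commute algebra_simps simp flip: scaleR_2)
    also have "\<dots> = reflection b x"
      using b by (simp add: sum_subtractf euclidean_representation reflection_def)
    finally show "0 + (\<Sum>j\<in>Basis. (c j * (x \<bullet> j)) *\<^sub>R j) = reflection b x" by simp
  qed
  have "lborel = density (distr lborel borel (reflection b)) (\<lambda>_. (\<Prod>j\<in>Basis. \<bar>c j\<bar>))"
    unfolding T[symmetric] by (rule lborel_affine_euclidean) (auto simp: c_def)
  also have "(\<Prod>j\<in>(Basis::'a set). \<bar>c j\<bar>) = 1" by (rule prod.neutral) (auto simp: c_def)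
  finally have eq: "distr lborel borel (reflection b) = (lborel :: 'a measure)"
    by (simp add: density_1 one_ennreal_def[symmetric])
  have [measurable]: "reflection b \<in> borel_measurable borel"
    by (rule borel_measurable_continuous_onI[OF continuous_reflection])
  have "(LINT x|lborel. F (reflection b x)) = (LINT x|distr lborel borel (reflection b). F x)"
    by (rule integral_distr[symmetric]) auto
  then show ?thesis by (simp add: eq)
qed

lemma test_function_reflection:
  assumes z: "test_function z g"
  shows "test_function (\<lambda>x. z (reflection l x)) (\<lambda>x. reflection l (g (reflection l x)))"
proof -
  obtain \<epsilon> R where *: "\<epsilon> > 0" "\<And>x. norm x < \<epsilon> \<or> R < norm x \<Longrightarrow> z x = 0"
    using test_function_support[OF z] by metis
  have "bounded_linear (reflection l)"
    unfolding reflection_def[abs_def]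
    by (intro bounded_linear_intros) (auto intro!: bounded_linear_intros simp: divide_inverse)
  then have "(reflection l has_derivative reflection l) (at x)" for x
    by (rule bounded_linear_imp_has_derivative)
  then have "((\<lambda>x. z (reflection l x)) has_derivative (\<lambda>h. g (reflection l x) \<bullet> reflection l h)) (at x)" for x
    by (rule has_derivative_compose[OF _ test_function_has_derivative[OF z]])
  moreover have "continuous_on UNIV (\<lambda>x. reflection l (g (reflection l x)))"
    by (intro continuous_on_compose2[OF continuous_reflection] continuous_on_compose2[OF
          test_function_continuous(2)[OF z] continuous_reflection]) auto
  ultimately show ?thesis
    using * unfolding test_function_def reflection_self_adjoint by (metis norm_reflection)
qed

lemma test_function_linear_combination:
  assumes z: "test_function z g" and w: "test_function w h"
  shows "test_function (\<lambda>x. a * z x + b * w x) (\<lambda>x. a *\<^sub>R g x + b *\<^sub>R h x)"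
proof -
  obtain \<epsilon> R where *: "\<epsilon> > 0" "\<And>x. norm x < \<epsilon> \<or> R < norm x \<Longrightarrow> z x = 0"
    using test_function_support[OF z] by metis
  obtain \<epsilon>' R' where **: "\<epsilon>' > 0" "\<And>x. norm x < \<epsilon>' \<or> R' < norm x \<Longrightarrow> w x = 0"
    using test_function_support[OF w] by metis
  show ?thesis
    unfolding test_function_def
  proof (intro conjI allI)
    show "((\<lambda>x. a * z x + b * w x) has_derivative (\<lambda>v. (a *\<^sub>R g x + b *\<^sub>R h x) \<bullet> v)) (at x)" for x
      by (auto intro!: derivative_eq_intros test_function_has_derivative z w simp: inner_add_left)
    show "continuous_on UNIV (\<lambda>x. a *\<^sub>R g x + b *\<^sub>R h x)"
      by (intro continuous_intros test_function_continuous[OF z] test_function_continuous[OF w])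
    show "\<exists>\<epsilon>>0. \<exists>R. \<forall>x. norm x < \<epsilon> \<or> R < norm x \<longrightarrow> a * z x + b * w x = 0"
      using * ** by (intro exI[of _ "min \<epsilon> \<epsilon>'"] exI[of _ "max R R'"] conjI) auto
  qed
qed

text \<open>The antipodal map is the product of the reflections in the coordinate hyperplanes; the partial
product over \<open>A\<close> maps \<open>x\<close> to \<open>x - (\<Sum>b\<in>A. 2 (b \<bullet> x) b)\<close>.\<close>

lemma even_coordinates_imp_even:
  fixes z :: "'a::euclidean_space \<Rightarrow> real"
  assumes "\<And>b x. b \<in> Basis \<Longrightarrow> z (reflection b x) = z x"
  shows "z (- x) = z x"
proof -
  have "z (x - (\<Sum>b\<in>A. (2 * (b \<bullet> x)) *\<^sub>R b)) = z x" if "finite A" "A \<subseteq> Basis" for A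
    using that
  proof induction
    case (insert c A)
    let ?y = "x - (\<Sum>b\<in>A. (2 * (b \<bullet> x)) *\<^sub>R b)"
    have "c \<bullet> b = 0" if "b \<in> A" for b
      using that insert by (intro inner_not_same_Basis) auto
    then have "c \<bullet> (\<Sum>b\<in>A. (2 * (b \<bullet> x)) *\<^sub>R b) = 0"
      by (simp add: inner_sum_right)
    then have "reflection c ?y = x - (\<Sum>b\<in>insert c A. (2 * (b \<bullet> x)) *\<^sub>R b)"
      using insert by (simp add: reflection_def inner_diff_right algebra_simps)
    then show ?case using assms[of c ?y] insert by simp
  qed simp
  from this[of Basis] have "z (x - 2 *\<^sub>R (\<Sum>b\<in>Basis. (b \<bullet> x) *\<^sub>R b)) = z x"
    by (simp add: scaleR_sum_right)
  also have "x - 2 *\<^sub>R (\<Sum>b\<in>Basis. (b \<bullet> x) *\<^sub>R b) = - x"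
  proof -
    have "(\<Sum>b\<in>Basis. (b \<bullet> x) *\<^sub>R b) = (\<Sum>b\<in>Basis. (x \<bullet> b) *\<^sub>R b)"
      by (intro sum.cong arg_cong2[of _ _ _ _ scaleR] inner_commute refl)
    then show ?thesis by (simp add: euclidean_representation scaleR_2)
  qed
  finally show ?thesis .
qed

lemma integral_linear_combination:
  fixes f h :: "'a \<Rightarrow> real"
  assumes "integrable M f" "integrable M h"
  shows "(LINT x|M. a * f x + b * h x) = a * (LINT x|M. f x) + b * (LINT x|M. h x)"
  using assms by (subst Bochner_Integration.integral_add) auto

text \<open>Induction over the set \<open>S\<close> of coordinates in which \<open>z\<close> need not be even. Splitting \<open>z\<close> into its odd
and even parts in one coordinate \<open>b \<in> S\<close> splits both sides of the inequality. The odd part is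
handled by a single root, the even part by induction. At the end, a function that is odd and even in
all coordinates is zero.\<close>

lemma hardy_odd_in_coordinates:
  fixes z :: "'a::euclidean_space \<Rightarrow> real"
  assumes "finite S" "S \<subseteq> Basis" "test_function z g" "\<And>x. z (- x) = - z x"
    "\<And>b x. b \<in> Basis - S \<Longrightarrow> z (reflection b x) = z x"
  shows "(LINT x|lborel. g x \<bullet> g x) \<ge> (real DIM('a) / 2)\<^sup>2 * (LINT x|lborel. (z x)\<^sup>2 / (x \<bullet> x))"
  using assms
proof (induction S arbitrary: z g)
  case empty
  then have "z x = 0" for x using even_coordinates_imp_even[of z x] by auto
  then show ?case by (simp add: integral_nonneg)
next
  case (insert b S)
  note z = insert.prems(2)
  have b: "b \<in> Basis" using insert.prems by auto
  define C where "C = (real DIM('a) / 2)\<^sup>2"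
  define w h where "w x = z (reflection b x)" and "h x = reflection b (g (reflection b x))" for x
  have w: "test_function w h" using test_function_reflection[OF z] by (simp add: w_def[abs_def] h_def[abs_def])
  \<comment> \<open>The odd and the even part in direction \<open>b\<close>, with their gradients.\<close>
  define zo go where "zo x = 1/2 * z x + (-1/2) * w x" and "go x = (1/2) *\<^sub>R g x + (-1/2) *\<^sub>R h x" for x
  define ze ge where "ze x = 1/2 * z x + 1/2 * w x" and "ge x = (1/2) *\<^sub>R g x + (1/2) *\<^sub>R h x" for x
  have o: "test_function zo go" and e: "test_function ze ge"
    unfolding zo_def[abs_def] go_def[abs_def] ze_def[abs_def] ge_def[abs_def]
    by (rule test_function_linear_combination[OF z w])+
  have "C * (LINT x|lborel. (zo x)\<^sup>2 / (x \<bullet> x)) \<le> (LINT x|lborel. go x \<bullet> go x)"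
    unfolding C_def using b
    by (intro hardy_single_root[OF o, of b]) (auto simp: zo_def w_def reflection_involution)
  moreover have "C * (LINT x|lborel. (ze x)\<^sup>2 / (x \<bullet> x)) \<le> (LINT x|lborel. ge x \<bullet> ge x)"
    unfolding C_def
  proof (rule insert.IH[OF _ e])
    show "S \<subseteq> Basis" using insert.prems by auto
    show "ze (- x) = - ze x" for x
      by (simp add: ze_def w_def reflection_uminus insert.prems)
    show "ze (reflection c x) = ze x" if c: "c \<in> Basis - S" for c x
    proof (cases "c = b")
      case True
      then show ?thesis by (simp add: ze_def w_def reflection_involution)
    next
      case False
      then have "c \<bullet> b = 0" using b c by (simp add: inner_Basis)
      then have "reflection b (reflection c x) = reflection c (reflection b x)"
        by (simp add: reflection_def inner_diff_right inner_commute[of b c])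
      then show ?thesis
        using False c insert.prems(4)[of c] by (simp add: ze_def w_def)
    qed
  qed
  moreover have "(LINT x|lborel. (zo x)\<^sup>2 / (x \<bullet> x)) + (LINT x|lborel. (ze x)\<^sup>2 / (x \<bullet> x)) =
      (LINT x|lborel. (z x)\<^sup>2 / (x \<bullet> x))"
  proof -
    note [measurable] = test_function_borel[OF z]
    have "(LINT x|lborel. (zo x)\<^sup>2 / (x \<bullet> x)) + (LINT x|lborel. (ze x)\<^sup>2 / (x \<bullet> x)) =
        (LINT x|lborel. 1/2 * ((z x)\<^sup>2 / (x \<bullet> x)) + 1/2 * ((w x)\<^sup>2 / (x \<bullet> x)))"
      unfolding Bochner_Integration.integral_add
        [OF integrable_hardy_weight[OF o] integrable_hardy_weight[OF e], symmetric]
    proof (rule arg_cong[of _ _ "integral\<^sup>L lborel"], rule ext)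
      fix x
      have "(zo x)\<^sup>2 + (ze x)\<^sup>2 = 1/2 * (z x)\<^sup>2 + 1/2 * (w x)\<^sup>2"
        by (simp add: zo_def ze_def power2_eq_square field_simps)
      then show "(zo x)\<^sup>2 / (x \<bullet> x) + (ze x)\<^sup>2 / (x \<bullet> x) =
          1/2 * ((z x)\<^sup>2 / (x \<bullet> x)) + 1/2 * ((w x)\<^sup>2 / (x \<bullet> x))"
        by (simp only: add_divide_distrib[symmetric] times_divide_eq_right)
    qed
    also have "\<dots> = 1/2 * (LINT x|lborel. (z x)\<^sup>2 / (x \<bullet> x)) + 1/2 * (LINT x|lborel. (w x)\<^sup>2 / (x \<bullet> x))"
      by (rule integral_linear_combination[OF integrable_hardy_weight[OF z] integrable_hardy_weight[OF w]])
    also have "(LINT x|lborel. (w x)\<^sup>2 / (x \<bullet> x)) = (LINT x|lborel. (z x)\<^sup>2 / (x \<bullet> x))"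
      using lborel_integral_reflection[OF b, of "\<lambda>x. (z x)\<^sup>2 / (x \<bullet> x)"] by (simp add: w_def inner_reflection_reflection)
    finally show ?thesis by simp
  qed
  moreover have "(LINT x|lborel. go x \<bullet> go x) + (LINT x|lborel. ge x \<bullet> ge x) = (LINT x|lborel. g x \<bullet> g x)"
  proof -
    note [measurable] = test_function_borel[OF z]
    have "(LINT x|lborel. go x \<bullet> go x) + (LINT x|lborel. ge x \<bullet> ge x) =
        (LINT x|lborel. 1/2 * (g x \<bullet> g x) + 1/2 * (h x \<bullet> h x))"
      unfolding Bochner_Integration.integral_add
        [OF integrable_gradient_square[OF o] integrable_gradient_square[OF e], symmetric]
      by (rule arg_cong[of _ _ "integral\<^sup>L lborel"], rule ext)
        (simp add: go_def ge_def inner_add_left inner_add_right inner_diff_left inner_diff_right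
          inner_commute field_simps)
    also have "\<dots> = 1/2 * (LINT x|lborel. g x \<bullet> g x) + 1/2 * (LINT x|lborel. h x \<bullet> h x)"
      by (rule integral_linear_combination[OF integrable_gradient_square[OF z] integrable_gradient_square[OF w]])
    also have "(LINT x|lborel. h x \<bullet> h x) = (LINT x|lborel. g x \<bullet> g x)"
      using lborel_integral_reflection[OF b, of "\<lambda>x. g x \<bullet> g x"] by (simp add: h_def inner_reflection_reflection)
    finally show ?thesis by simp
  qed
  moreover have "C * v \<le> V" if "C * a \<le> A" "C * b \<le> B" "a + b = v" "A + B = V" for a b v A B V
    using that by (auto simp: distrib_left)
  ultimately have "C * (LINT x|lborel. (z x)\<^sup>2 / (x \<bullet> x)) \<le> (LINT x|lborel. g x \<bullet> g x)"
    by blast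
  then show ?case by (simp add: C_def)
qed

lemma hardy_odd:
  fixes z :: "'a::euclidean_space \<Rightarrow> real"
  assumes "test_function z g" "\<And>x. z (- x) = - z x"
  shows "(LINT x|lborel. g x \<bullet> g x) \<ge> (real DIM('a) / 2)\<^sup>2 * (LINT x|lborel. (z x)\<^sup>2 / (x \<bullet> x))"
  using hardy_odd_in_coordinates[of Basis z g] assms by auto

section \<open>Radial weights and the exponent \<open>p\<close>\<close>

text \<open>The mixed term of the square is \<open>k\<close> times the derivative of \<open>z\<^sup>2\<close> along \<open>x/|x|\<^sup>2\<close>, and integration by
parts along that field turns it into a multiple of \<open>\<integral>z\<^sup>2/|x|\<^sup>2\<close>.\<close>

lemma weighted_energy_identity:
  fixes z :: "'a::euclidean_space \<Rightarrow> real" and k :: real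
  assumes z: "test_function z g"
  defines "E \<equiv> (\<lambda>x. (norm (g x + (k * z x / (x \<bullet> x)) *\<^sub>R x))\<^sup>2)"
  shows "integrable lborel E"
    "(LINT x|lborel. E x) = (LINT x|lborel. g x \<bullet> g x)
       + (k\<^sup>2 - k * (real DIM('a) - 2)) * (LINT x|lborel. (z x)\<^sup>2 / (x \<bullet> x))"
proof -
  define rad where "rad x = 2 * z x * (g x \<bullet> x) / (x \<bullet> x) + (real DIM('a) - 2) * (z x)\<^sup>2 / (x \<bullet> x)" for x
  note rad = integral_radial_term[OF z, folded rad_def]
  define C where "C = k\<^sup>2 - k * (real DIM('a) - 2)"
  have E: "E x = (g x \<bullet> g x + k * rad x) + C * ((z x)\<^sup>2 / (x \<bullet> x))" for x
  proof (cases "x = 0")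
    case True
    then show ?thesis by (simp add: E_def rad_def power2_norm_eq_inner)
  next
    case False
    define r where "r = 1 / (x \<bullet> x)"
    have rr: "r * r * (x \<bullet> x) = r" by (simp add: r_def)
    have "E x = (g x + (k * z x * r) *\<^sub>R x) \<bullet> (g x + (k * z x * r) *\<^sub>R x)"
      by (simp add: E_def r_def power2_norm_eq_inner)
    also have "\<dots> = g x \<bullet> g x + 2 * k * z x * r * (g x \<bullet> x) + k\<^sup>2 * (z x)\<^sup>2 * (r * r * (x \<bullet> x))"
      by (simp add: inner_add_left inner_add_right inner_commute[of x "g x"] algebra_simps power2_eq_square)
    also have "\<dots> = (g x \<bullet> g x + k * rad x) + C * ((z x)\<^sup>2 * r)"
      unfolding rr by (simp add: rad_def C_def r_def[symmetric] algebra_simps divide_inverse r_def)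
    finally show ?thesis by (simp add: r_def)
  qed
  have i: "integrable lborel (\<lambda>x. g x \<bullet> g x + k * rad x)"
    by (intro Bochner_Integration.integrable_add integrable_mult_right rad integrable_gradient_square[OF z])
  show "integrable lborel E"
    unfolding E by (intro Bochner_Integration.integrable_add integrable_mult_right i integrable_hardy_weight[OF z])
  have "(LINT x|lborel. E x) = (LINT x|lborel. g x \<bullet> g x + k * rad x)
      + C * (LINT x|lborel. (z x)\<^sup>2 / (x \<bullet> x))"
    unfolding E using integral_linear_combination[OF i integrable_hardy_weight[OF z], of 1 C] by simp
  also have "(LINT x|lborel. g x \<bullet> g x + k * rad x) = (LINT x|lborel. g x \<bullet> g x)"
    using integral_linear_combination[OF integrable_gradient_square[OF z] rad(1), of 1 k] rad(2) by simp
  finally show "(LINT x|lborel. E x) = (LINT x|lborel. g x \<bullet> g x)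
       + (k\<^sup>2 - k * (real DIM('a) - 2)) * (LINT x|lborel. (z x)\<^sup>2 / (x \<bullet> x))"
    by (simp add: C_def)
qed

text \<open>Bernoulli's inequality, from the weighted arithmetic-geometric mean inequality for \<open>s\<^sup>q\<close> and \<open>1\<close>.\<close>

lemma powr_ge_tangent:
  fixes s q :: real
  assumes "s \<ge> 0" "q \<ge> 1"
  shows "1 + q * (s - 1) \<le> s powr q"
proof (cases "s = 0")
  case True
  then show ?thesis using assms by simp
next
  case False
  then have "(s powr q) powr (1 / q) * 1 powr (1 - 1 / q) \<le> 1 / q * s powr q + (1 - 1 / q) * 1"
    using assms by (intro Youngs_inequality_0) auto
  then have "s \<le> 1 / q * s powr q + (1 - 1 / q)"
    using assms False by (simp add: powr_powr)
  then have "q * s \<le> q * (1 / q * s powr q + (1 - 1 / q))"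
    using assms by (intro mult_left_mono) auto
  also have "\<dots> = s powr q + q - 1" using assms by (simp add: field_simps)
  finally show ?thesis by (simp add: algebra_simps)
qed

text \<open>The tangent line of \<open>s \<mapsto> s\<^bsup>p/2\<^esup>\<close> at \<open>s = c\<close>, evaluated at \<open>s = y\<^sup>2\<close>.\<close>

lemma powr_ge_tangent_square:
  fixes c p y :: real
  assumes "p \<ge> 2" "c > 0" "y \<ge> 0"
  shows "c powr (p / 2) + c powr (p / 2 - 1) * (p / 2) * (y\<^sup>2 - c) \<le> y powr p"
proof -
  have c: "c powr (p / 2) = c powr (p / 2 - 1) * c"
    using assms by (simp add: powr_diff)
  have y: "(y\<^sup>2) powr (p / 2) = y powr p"
    using assms by (cases "y = 0") (simp_all add: powr_powr flip: powr_numeral)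
  have "c powr (p / 2) + c powr (p / 2 - 1) * (p / 2) * (y\<^sup>2 - c)
      = c powr (p / 2) * (1 + p / 2 * (y\<^sup>2 / c - 1))"
    using assms unfolding c by (simp add: field_simps)
  also have "\<dots> \<le> c powr (p / 2) * (y\<^sup>2 / c) powr (p / 2)"
    using assms by (intro mult_left_mono powr_ge_tangent) auto
  also have "\<dots> = y powr p"
    using assms y by (simp add: powr_divide)
  finally show ?thesis .
qed

definition signed_power :: "real \<Rightarrow> real \<Rightarrow> real" where
  "signed_power q s = s * \<bar>s\<bar> powr (q - 1)"

text \<open>For \<open>q = 1\<close> the general formula would give \<open>0\<close> instead of \<open>1\<close> at the origin, because
\<open>0 powr 0 = 0\<close>.\<close>

definition signed_power_deriv :: "real \<Rightarrow> real \<Rightarrow> real" where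
  "signed_power_deriv q s = (if q = 1 then 1 else q * \<bar>s\<bar> powr (q - 1))"

lemma signed_power_has_derivative:
  assumes "q \<ge> 1"
  shows "(signed_power q has_real_derivative signed_power_deriv q s) (at s)"
proof (cases "q = 1")
  case True
  then have "signed_power q = (\<lambda>s. s)" by (auto simp: signed_power_def)
  then show ?thesis using True by (simp add: signed_power_deriv_def)
next
  case False
  then have q: "q > 1" using assms by simp
  consider "s > 0" | "s < 0" | "s = 0" by linarith
  then show ?thesis
  proof cases
    case 1
    have "((\<lambda>s. s powr q) has_real_derivative q * s powr (q - 1)) (at s)"
      by (rule has_real_derivative_powr[OF 1])
    then have "(signed_power q has_real_derivative q * s powr (q - 1)) (at s)"
      by (rule DERIV_cong_ev[OF refl _ refl, THEN iffD1, rotated])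
        (use 1 in \<open>auto simp: eventually_nhds signed_power_def powr_diff intro!: exI[of _ "{0<..}"]\<close>)
    then show ?thesis using 1 False by (simp add: signed_power_deriv_def)
  next
    case 2
    have "((\<lambda>s. - ((- s) powr q)) has_real_derivative q * (- s) powr (q - 1)) (at s)"
      using 2 by (auto intro!: derivative_eq_intros DERIV_chain2[OF has_real_derivative_powr] simp: powr_diff)
    then have "(signed_power q has_real_derivative q * (- s) powr (q - 1)) (at s)"
      by (rule DERIV_cong_ev[OF refl _ refl, THEN iffD1, rotated])
        (use 2 in \<open>auto simp: eventually_nhds signed_power_def powr_diff intro!: exI[of _ "{..<0}"]\<close>)
    then show ?thesis using 2 False by (simp add: signed_power_deriv_def)
  next
    case 3
    have "((\<lambda>h::real. \<bar>h\<bar> powr (q - 1)) \<longlongrightarrow> \<bar>0\<bar> powr (q - 1)) (at 0)"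
      using q by (intro tendsto_powr' tendsto_intros) auto
    moreover have "\<forall>\<^sub>F h in at 0. \<bar>h\<bar> powr (q - 1) = (signed_power q (0 + h) - signed_power q 0) / h"
      by (auto simp: eventually_at_filter signed_power_def)
    ultimately have "((\<lambda>h. (signed_power q (0 + h) - signed_power q 0) / h) \<longlongrightarrow> 0) (at 0)"
      by (auto intro: Lim_transform_eventually)
    then show ?thesis using 3 False by (simp add: has_field_derivative_iff signed_power_deriv_def)
  qed
qed

lemma continuous_signed_power_deriv:
  assumes "q \<ge> 1"
  shows "continuous_on UNIV (signed_power_deriv q)"
proof (cases "q = 1")
  case True
  then show ?thesis by (simp add: signed_power_deriv_def[abs_def])
next
  case False
  then have "continuous_on UNIV (\<lambda>s::real. q * \<bar>s\<bar> powr (q - 1))"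
    using assms by (intro continuous_intros continuous_on_powr') auto
  then show ?thesis using False by (simp add: signed_power_deriv_def[abs_def])
qed

lemma test_function_radial_weight:
  assumes v: "test_function v h"
  shows "test_function (\<lambda>x. (x \<bullet> x) powr b * v x)
    (\<lambda>x. (x \<bullet> x) powr b *\<^sub>R h x + v x *\<^sub>R ((2 * b * (x \<bullet> x) powr (b - 1)) *\<^sub>R x))"
proof (rule test_function_times[OF v])
  show "((\<lambda>x. (x \<bullet> x) powr b) has_derivative (\<lambda>h. ((2 * b * (x \<bullet> x) powr (b - 1)) *\<^sub>R x) \<bullet> h)) (at x)"
    if "x \<noteq> 0" for x :: 'a
  proof -
    have "((\<lambda>y. y \<bullet> y) has_derivative (\<lambda>h. 2 * (x \<bullet> h))) (at x)"
      by (auto intro!: derivative_eq_intros simp: inner_commute)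
    moreover have "((\<lambda>s. s powr b) has_derivative (\<lambda>t. b * (x \<bullet> x) powr (b - 1) * t)) (at (x \<bullet> x))"
      using has_real_derivative_powr[of "x \<bullet> x" b] that by (simp add: has_field_derivative_def)
    ultimately have "((\<lambda>y. (y \<bullet> y) powr b) has_derivative (\<lambda>h. b * (x \<bullet> x) powr (b - 1) * (2 * (x \<bullet> h)))) (at x)"
      by (rule has_derivative_compose)
    then show ?thesis by (rule has_derivative_eq_rhs) (simp add: fun_eq_iff)
  qed
  show "continuous_on (- {0}) (\<lambda>x::'a. (2 * b * (x \<bullet> x) powr (b - 1)) *\<^sub>R x)"
    by (intro continuous_intros) auto
qed

text \<open>The factor \<open>(x \<bullet> x) powr (- k / 2)\<close> is \<open>|x|\<^bsup>-k\<^esup>\<close>. In terms of \<open>a = |u|\<^sup>p/|x|\<^bsup>p+\<gamma>\<^esup>\<close> and the scale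
invariant ratio \<open>y = |\<nabla>u| |x| / |u|\<close>, the density on the left is \<open>a y\<^sup>p\<close> and the quadratic density,
normalised by \<open>4/p\<^sup>2\<close>, is \<open>a y\<^sup>2\<close>. Hence a tangent line to the \<open>p/2\<close>-th power at \<open>y\<^sup>2 = c\<close> bounds the
first from below by the second and by \<open>a\<close>, and after integration the assumed inequality for \<open>z\<close> makes
the first-order term nonnegative.\<close>

lemma hardy_power:
  fixes u :: "'a::euclidean_space \<Rightarrow> real" and p \<gamma> H :: real
  assumes u: "test_function u g" and p: "p \<ge> 2"
  defines "k \<equiv> (p - 2 + \<gamma>) / 2"
  defines "z \<equiv> (\<lambda>x. (x \<bullet> x) powr (- k / 2) * signed_power (p / 2) (u x))"
  defines "c \<equiv> 4 / p\<^sup>2 * (H + k\<^sup>2 - k * (real DIM('a) - 2))"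
  assumes H: "\<And>h. test_function z h \<Longrightarrow>
      (LINT x|lborel. h x \<bullet> h x) \<ge> H * (LINT x|lborel. (z x)\<^sup>2 / (x \<bullet> x))"
    and c: "c \<ge> 0"
  shows "(LINT x|lborel. norm (g x) powr p / norm x powr \<gamma>)
    \<ge> c powr (p / 2) * (LINT x|lborel. \<bar>u x\<bar> powr p / norm x powr (p + \<gamma>))"
proof (cases "c = 0")
  case True
  then show ?thesis by (simp add: integral_nonneg)
next
  case False
  with c have c: "c > 0" by simp
  define v hv where "v x = signed_power (p / 2) (u x)"
    and "hv x = signed_power_deriv (p / 2) (u x) *\<^sub>R g x" for x
  have v: "test_function v hv"
    unfolding v_def[abs_def] hv_def[abs_def] using p
    by (intro test_function_compose[OF u] signed_power_has_derivative continuous_signed_power_deriv)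
      (auto simp: signed_power_def)
  define h where "h x = (x \<bullet> x) powr (- k / 2) *\<^sub>R hv x
      + v x *\<^sub>R ((2 * (- k / 2) * (x \<bullet> x) powr (- k / 2 - 1)) *\<^sub>R x)" for x
  have z: "test_function z h"
    using test_function_radial_weight[OF v, of "- k / 2"]
    unfolding z_def h_def[abs_def] v_def[symmetric] .
  obtain \<epsilon> R where \<epsilon>: "\<epsilon> > 0" "\<And>x. norm x < \<epsilon> \<or> R < norm x \<Longrightarrow> u x = 0"
     "\<And>x. norm x < \<epsilon> \<or> R < norm x \<Longrightarrow> g x = 0"
    using test_function_support[OF u] by metis
  define a \<beta> E where "a x = \<bar>u x\<bar> powr p / norm x powr (p + \<gamma>)"
    and "\<beta> x = norm (g x) powr p / norm x powr \<gamma>"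
    and "E x = (norm (h x + (k * z x / (x \<bullet> x)) *\<^sub>R x))\<^sup>2" for x
  have norm_powr: "(x \<bullet> x) powr s = norm x powr (2 * s)" for x :: 'a and s
    by (cases "x = 0") (simp_all add: dot_square_norm powr_powr flip: powr_numeral)
  have powr_square: "(t powr s)\<^sup>2 = t powr (2 * s)" for t s :: real
    by (simp add: power2_eq_square powr_add[symmetric])
  have a: "(z x)\<^sup>2 / (x \<bullet> x) = a x" for x
  proof (cases "x = 0 \<or> u x = 0")
    case True
    then show ?thesis using \<epsilon>(1) \<epsilon>(2)[of x] p by (auto simp: z_def a_def signed_power_def)
  next
    case False
    have "(z x)\<^sup>2 = (norm x powr (- k) * (\<bar>u x\<bar> * \<bar>u x\<bar> powr (p / 2 - 1)))\<^sup>2"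
      by (simp add: z_def signed_power_def norm_powr power_mult_distrib)
    also have "\<dots> = norm x powr (- (2 * k)) * \<bar>u x\<bar> powr p"
      by (simp add: powr_mult_base power_mult_distrib powr_square)
    also have "\<dots> = \<bar>u x\<bar> powr p / norm x powr (2 * k)"
      by (simp add: powr_minus_divide)
    finally have "(z x)\<^sup>2 / (x \<bullet> x) = \<bar>u x\<bar> powr p / (norm x powr (2 * k) * norm x powr 2)"
      using False by (simp add: dot_square_norm powr_numeral)
    also have "norm x powr (2 * k) * norm x powr 2 = norm x powr (p + \<gamma>)"
    proof -
      have "2 * k + 2 = p + \<gamma>" by (simp add: k_def field_simps)
      then show ?thesis by (simp only: powr_add[symmetric])
    qed
    finally show ?thesis by (simp add: a_def)
  qed
  have E: "E x = signed_power_deriv (p / 2) (u x) ^ 2 * norm (g x) ^ 2 / norm x powr (2 * k)" for x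
  proof (cases "x = 0")
    case True
    then show ?thesis using \<epsilon>(1) \<epsilon>(2,3)[of x] by (simp add: E_def h_def hv_def v_def signed_power_def)
  next
    case False
    then have "(x \<bullet> x) powr (- k / 2 - 1) = (x \<bullet> x) powr (- k / 2) / (x \<bullet> x)"
      by (simp add: powr_diff)
    \<comment> \<open>The added term undoes the derivative of the weight.\<close>
    then have "h x + (k * z x / (x \<bullet> x)) *\<^sub>R x = (x \<bullet> x) powr (- k / 2) *\<^sub>R hv x"
      by (simp add: h_def z_def v_def)
    then have "E x = (norm x powr (- k) * (\<bar>signed_power_deriv (p / 2) (u x)\<bar> * norm (g x)))\<^sup>2"
      by (simp add: E_def hv_def norm_powr abs_mult)
    also have "\<dots> = (norm x powr (- k))\<^sup>2 * (signed_power_deriv (p / 2) (u x) ^ 2 * norm (g x) ^ 2)"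
      by (simp add: power_mult_distrib)
    also have "(norm x powr (- k))\<^sup>2 = 1 / norm x powr (2 * k)"
      unfolding powr_square by (simp add: powr_minus_divide)
    finally show ?thesis by simp
  qed
  have pointwise: "c powr (p / 2) * a x + c powr (p / 2 - 1) * (p / 2) * (4 / p\<^sup>2 * E x - c * a x) \<le> \<beta> x" for x
  proof -
    consider "x = 0" | "x \<noteq> 0" "p = 2" | "x \<noteq> 0" "p > 2" "u x = 0" | "x \<noteq> 0" "p > 2" "u x \<noteq> 0"
      using p by fastforce
    then show ?thesis
    proof cases
      case 1
      then show ?thesis using \<epsilon>(1) \<epsilon>(2,3)[of x] by (simp add: a_def E \<beta>_def)
    next
      case 2
      \<comment> \<open>For \<open>p = 2\<close> the two densities coincide, also at the zeros of \<open>u\<close>.\<close>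
      then have "E x = \<beta> x"
        by (simp add: E \<beta>_def signed_power_deriv_def k_def powr_numeral)
      then show ?thesis using 2 c by simp
    next
      case 3
      then show ?thesis by (simp add: a_def E \<beta>_def signed_power_deriv_def)
    next
      case 4
      define y where "y = norm (g x) * norm x / \<bar>u x\<bar>"
      have pos: "\<bar>u x\<bar> > 0" "norm x > 0" using 4 by auto
      have "\<beta> x = a x * y powr p"
        using pos by (simp add: \<beta>_def a_def y_def powr_mult powr_divide powr_add)
      moreover have "4 / p\<^sup>2 * E x = a x * y\<^sup>2"
      proof -
        have "signed_power_deriv (p / 2) (u x) ^ 2 = p\<^sup>2 / 4 * (\<bar>u x\<bar> powr (p / 2 - 1)) ^ 2"
          using 4 by (simp add: signed_power_deriv_def power_mult_distrib power_divide)
        also have "(\<bar>u x\<bar> powr (p / 2 - 1)) ^ 2 = \<bar>u x\<bar> powr (p - 2)"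
          unfolding powr_square by (simp add: right_diff_distrib)
        also have "\<bar>u x\<bar> powr (p - 2) = \<bar>u x\<bar> powr p / \<bar>u x\<bar> ^ 2"
          using pos by (simp add: powr_diff powr_numeral)
        finally have "4 / p\<^sup>2 * E x = \<bar>u x\<bar> powr p / \<bar>u x\<bar> ^ 2 * norm (g x) ^ 2 / norm x powr (2 * k)"
          using p by (simp add: E)
        also have "norm x powr (2 * k) = norm x powr (p + \<gamma>) / norm x ^ 2"
        proof -
          have "2 * k = (p + \<gamma>) - 2" by (simp add: k_def field_simps)
          then have "norm x powr (2 * k) = norm x powr (p + \<gamma>) / norm x powr 2"
            by (simp only: powr_diff)
          then show ?thesis using pos by (simp add: powr_numeral)
        qed
        finally show ?thesis by (simp add: a_def y_def power_mult_distrib power_divide mult_ac)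
      qed
      moreover have "a x * (c powr (p / 2) + c powr (p / 2 - 1) * (p / 2) * (y\<^sup>2 - c)) \<le> a x * y powr p"
        using p c pos by (intro mult_left_mono powr_ge_tangent_square) (auto simp: y_def a_def)
      ultimately show ?thesis by (simp add: algebra_simps)
    qed
  qed
  have ia: "integrable lborel a"
    using integrable_hardy_weight[OF z] unfolding a .
  note E_int = weighted_energy_identity[OF z, of k, folded E_def]
  have i\<beta>: "integrable lborel \<beta>"
  proof (rule integrable_annulus[OF _ \<epsilon>(1)])
    show "continuous_on (- {0}) \<beta>"
      unfolding \<beta>_def using p
      by (intro continuous_intros continuous_on_powr' continuous_on_subset[OF test_function_continuous(2)[OF u]]) auto
  qed (use \<epsilon>(3) in \<open>auto simp: \<beta>_def\<close>)
  define d where "d = c powr (p / 2 - 1) * (p / 2)"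
  have "d \<ge> 0" using p by (simp add: d_def)
  have "p\<^sup>2 / 4 * c * integral\<^sup>L lborel a \<le> integral\<^sup>L lborel E"
  proof -
    have "p\<^sup>2 / 4 * c = H + (k\<^sup>2 - k * (real DIM('a) - 2))"
      using p by (simp add: c_def)
    then have "p\<^sup>2 / 4 * c * integral\<^sup>L lborel a = H * integral\<^sup>L lborel a
        + (k\<^sup>2 - k * (real DIM('a) - 2)) * integral\<^sup>L lborel a"
      by (simp only: distrib_right)
    also have "\<dots> \<le> integral\<^sup>L lborel E"
      unfolding E_int(2)[unfolded a] by (intro add_right_mono H[OF z, unfolded a])
    finally show ?thesis .
  qed
  then have "4 / p\<^sup>2 * (p\<^sup>2 / 4 * c * integral\<^sup>L lborel a) \<le> 4 / p\<^sup>2 * integral\<^sup>L lborel E"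
    by (intro mult_left_mono) auto
  then have "0 \<le> d * (4 / p\<^sup>2 * integral\<^sup>L lborel E - c * integral\<^sup>L lborel a)"
    using p \<open>d \<ge> 0\<close> by (intro mult_nonneg_nonneg) auto
  then have "c powr (p / 2) * integral\<^sup>L lborel a
      \<le> (c powr (p / 2) - d * c) * integral\<^sup>L lborel a + (d * (4 / p\<^sup>2)) * integral\<^sup>L lborel E"
    by (simp add: algebra_simps)
  also have "\<dots> = (LINT x|lborel. (c powr (p / 2) - d * c) * a x + (d * (4 / p\<^sup>2)) * E x)"
    by (rule integral_linear_combination[OF ia E_int(1), symmetric])
  also have "\<dots> \<le> integral\<^sup>L lborel \<beta>"
  proof (rule integral_mono[OF _ i\<beta>])
    show "integrable lborel (\<lambda>x. (c powr (p / 2) - d * c) * a x + (d * (4 / p\<^sup>2)) * E x)"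
      by (intro Bochner_Integration.integrable_add integrable_mult_right ia E_int)
    show "(c powr (p / 2) - d * c) * a x + (d * (4 / p\<^sup>2)) * E x \<le> \<beta> x" for x
      using pointwise[of x] by (simp add: d_def algebra_simps)
  qed
  finally show ?thesis by (simp add: a_def[abs_def] \<beta>_def[abs_def])
qed

lemma C1_compact_support_imp_test_function:
  fixes u :: "real ^ 'n \<Rightarrow> real"
  assumes "u \<in> C1_compact_support (- {0})"
  shows "test_function u (grad u)"
proof -
  define S where "S = closure {x. u x \<noteq> 0}"
  have u: "u differentiable_on - {0}" "continuous_on (- {0}) (grad u)" "compact S" "0 \<notin> S"
    using assms by (auto simp: C1_compact_support_def S_def)
  have zero: "u x = 0" if "x \<notin> S" for x using that closure_subset[of "{x. u x \<noteq> 0}"] by (auto simp: S_def)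
  obtain R where R: "\<And>x. x \<in> S \<Longrightarrow> norm x \<le> R"
    using compact_imp_bounded[OF u(3)] bounded_iff by metis
  have "open (- S)" using compact_imp_closed[OF u(3)] by auto
  then obtain \<epsilon> where \<epsilon>: "\<epsilon> > 0" "ball 0 \<epsilon> \<subseteq> - S"
    using u(4) by (meson ComplI open_contains_ball)
  have near: "(u has_derivative (\<lambda>_. 0)) (at x)" if "norm x < \<epsilon>" for x
    by (rule has_derivative_transform_within_open[of "\<lambda>_. 0" _ _ _ "ball 0 \<epsilon>"])
      (use that \<epsilon> zero in auto)
  have der: "(u has_derivative (\<lambda>h. grad u x \<bullet> h)) (at x)" for x
  proof -
    have "u differentiable (at x)"
    proof (cases "x = 0")
      case True
      then show ?thesis using near[of 0] \<epsilon>(1) by (auto simp: differentiable_def)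
    next
      case False
      then show ?thesis
        using u(1) by (simp add: differentiable_on_eq_differentiable_at open_Compl)
    qed
    then have d: "(u has_derivative frechet_derivative u (at x)) (at x)"
      by (simp add: frechet_derivative_works)
    then interpret bounded_linear "frechet_derivative u (at x)" by (rule has_derivative_bounded_linear)
    have "frechet_derivative u (at x) h = grad u x \<bullet> h" for h
    proof -
      have "frechet_derivative u (at x) h = frechet_derivative u (at x) (\<Sum>i\<in>UNIV. (h $ i) *\<^sub>R axis i 1)"
        using basis_expansion[of h] by (simp add: scalar_mult_eq_scaleR)
      also have "\<dots> = grad u x \<bullet> h"
        by (simp add: sum scaleR grad_def inner_vec_def mult.commute)
      finally show ?thesis .
    qed
    then have "frechet_derivative u (at x) = (\<lambda>h. grad u x \<bullet> h)" by (rule ext)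
    with d show ?thesis by simp
  qed
  have grad_zero: "grad u x = 0" if "norm x < \<epsilon>" for x
  proof -
    have "(\<lambda>h. grad u x \<bullet> h) = (\<lambda>_. 0)"
      using has_derivative_unique[OF der near[OF that]] .
    then have "grad u x \<bullet> grad u x = 0" by (rule fun_cong)
    then show ?thesis by simp
  qed
  have "continuous_on (ball 0 \<epsilon>) (grad u)"
    by (rule continuous_on_eq[OF continuous_on_const[of _ 0]]) (simp add: grad_zero)
  then have "continuous_on (- {0} \<union> ball 0 \<epsilon>) (grad u)"
    using u(2) by (intro continuous_on_open_Un) auto
  moreover have "- {0} \<union> ball 0 \<epsilon> = (UNIV :: (real ^ 'n) set)" using \<epsilon>(1) by auto
  moreover have "u x = 0" if "norm x < \<epsilon> \<or> R < norm x" for x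
    using that \<epsilon>(2) R[of x] by (intro zero) auto
  ultimately show ?thesis
    using der \<epsilon>(1) unfolding test_function_def by auto
qed

theorem theorem4:
  fixes \<gamma> p :: real
  assumes "p \<ge> 2"
  shows "(\<forall>u :: real ^ 'n \<Rightarrow> real.
            CARD('n) \<ge> 2 \<longrightarrow> u \<in> C1_compact_support (- {0}) \<longrightarrow> antisymmetric u \<longrightarrow>
            (LINT x|lborel. norm (grad u x) powr p / norm x powr \<gamma>)
              \<ge> C_H CARD('n) p \<gamma> * (LINT x|lborel. \<bar>u x\<bar> powr p / norm x powr (p + \<gamma>)))
       \<and> (\<forall>u :: real ^ 'n \<Rightarrow> real.
            CARD('n) \<ge> 1 \<longrightarrow> u \<in> C1_compact_support (- {0}) \<longrightarrow> odd_function u \<longrightarrow>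
            (LINT x|lborel. norm (grad u x) powr p / norm x powr \<gamma>)
              \<ge> D_H CARD('n) p \<gamma> * (LINT x|lborel. \<bar>u x\<bar> powr p / norm x powr (p + \<gamma>)))"
proof (intro conjI allI impI)
  define k where "k = (p - 2 + \<gamma>) / 2"
  define z where "z u x = (x \<bullet> x) powr (- k / 2) * signed_power (p / 2) (u x)"
    for u and x :: "real ^ 'n"
  \<comment> \<open>The weight is worst at \<open>k = (d-2)/2\<close>; the constants stay nonnegative because \<open>H\<close> is at least \<open>((d-2)/2)\<^sup>2\<close>.\<close>
  have kd: "k\<^sup>2 - k * (real CARD('n) - 2) = (k - (real CARD('n) - 2) / 2)\<^sup>2 - ((real CARD('n) - 2) / 2)\<^sup>2"
    by (simp add: power2_eq_square field_simps)
  {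
    fix u :: "real ^ 'n \<Rightarrow> real"
    assume d: "2 \<le> CARD('n)" and u: "u \<in> C1_compact_support (- {0})" and anti: "antisymmetric u"
    define H where "H = (((real CARD('n))\<^sup>2 - 2) / 2)\<^sup>2"
    define c where "c = 4 / p\<^sup>2 * (H + k\<^sup>2 - k * (real DIM(real ^ 'n) - 2))"
    have perm: "(\<chi> k. x $ Transposition.transpose i j k) \<bullet> (\<chi> k. x $ Transposition.transpose i j k) = x \<bullet> x"
      if "i \<noteq> j" for i j and x :: "real ^ 'n"
      using inner_reflection_reflection[of "axis i 1 - axis j 1" x x] that by (simp add: reflection_axis_difference)
    have "antisymmetric (z u)"
      using anti by (simp add: antisymmetric_def z_def perm signed_power_def)
    then have "H * (LINT x|lborel. (z u x)\<^sup>2 / (x \<bullet> x)) \<le> (LINT x|lborel. h x \<bullet> h x)"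
      if "test_function (z u) h" for h
      using hardy_antisymmetric[OF that] by (simp add: H_def)
    moreover have "c \<ge> 0"
    proof -
      have "real CARD('n) * 1 \<le> real CARD('n) * real CARD('n)"
        using d by (intro mult_left_mono) auto
      then have "((real CARD('n) - 2) / 2)\<^sup>2 \<le> H"
        unfolding H_def using d by (intro power_mono) (auto simp: power2_eq_square)
      then have "0 \<le> H + (k\<^sup>2 - k * (real CARD('n) - 2))" 
        unfolding kd using zero_le_power2[of "k - (real CARD('n) - 2) / 2"] by linarith
      then show ?thesis by (simp add: c_def)
    qed
    ultimately have "c powr (p / 2) * (LINT x|lborel. \<bar>u x\<bar> powr p / norm x powr (p + \<gamma>))
        \<le> (LINT x|lborel. norm (grad u x) powr p / norm x powr \<gamma>)"
      unfolding c_def k_def z_def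
      by (intro hardy_power[OF C1_compact_support_imp_test_function[OF u] assms]) auto
    moreover have "c = 2 * (p - 2 + \<gamma>) * real CARD('n) * (real CARD('n) - 1) / p\<^sup>2
        + (((real CARD('n))\<^sup>2 - p - \<gamma>) / p)\<^sup>2"
      using assms by (simp add: c_def H_def k_def field_simps power2_eq_square)
    ultimately show "C_H CARD('n) p \<gamma> * (LINT x|lborel. \<bar>u x\<bar> powr p / norm x powr (p + \<gamma>))
        \<le> (LINT x|lborel. norm (grad u x) powr p / norm x powr \<gamma>)"
      by (simp add: C_H_def)
  next
    fix u :: "real ^ 'n \<Rightarrow> real"
    assume d: "1 \<le> CARD('n)" and u: "u \<in> C1_compact_support (- {0})" and odd: "odd_function u"
    define H where "H = (real CARD('n) / 2)\<^sup>2"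
    define c where "c = 4 / p\<^sup>2 * (H + k\<^sup>2 - k * (real DIM(real ^ 'n) - 2))"
    have "z u (- x) = - z u x" for x
      using odd by (simp add: odd_function_def z_def signed_power_def)
    then have "H * (LINT x|lborel. (z u x)\<^sup>2 / (x \<bullet> x)) \<le> (LINT x|lborel. h x \<bullet> h x)"
      if "test_function (z u) h" for h
      using hardy_odd[OF that] by (simp add: H_def)
    moreover have "c \<ge> 0"
    proof -
      have "((real CARD('n) - 2) / 2)\<^sup>2 \<le> H"
        unfolding H_def using d by (simp add: power2_eq_square field_simps)
      then have "0 \<le> H + (k\<^sup>2 - k * (real CARD('n) - 2))" 
        unfolding kd using zero_le_power2[of "k - (real CARD('n) - 2) / 2"] by linarith
      then show ?thesis by (simp add: c_def)
    qed
    ultimately have "c powr (p / 2) * (LINT x|lborel. \<bar>u x\<bar> powr p / norm x powr (p + \<gamma>))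
        \<le> (LINT x|lborel. norm (grad u x) powr p / norm x powr \<gamma>)"
      unfolding c_def k_def z_def
      by (intro hardy_power[OF C1_compact_support_imp_test_function[OF u] assms]) auto
    moreover have "c = 4 * (p - 2 + \<gamma>) / p\<^sup>2 + ((real CARD('n) - p - \<gamma> + 2) / p)\<^sup>2"
      using assms by (simp add: c_def H_def k_def field_simps power2_eq_square)
    ultimately show "D_H CARD('n) p \<gamma> * (LINT x|lborel. \<bar>u x\<bar> powr p / norm x powr (p + \<gamma>))
        \<le> (LINT x|lborel. norm (grad u x) powr p / norm x powr \<gamma>)"
      by (simp add: D_H_def)
  }
qed

end
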